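(* Let $\Omega\subseteq\mathbb{R}$ be an open interval with $0\in\Omega$. Let $\phi\colon\Omega\to\phi(\Omega)=\mathbb{R}$ be a homeomorphism with $\phi(0)=0$ and $\phi(s)s>0$ for all $s\in\Omega\setminus\{0\}$. Let $0<\tau<T$, $a_{+},a_{-}>0$, and let $a\in L^{\infty}(0,T)$ be given by $a(t)=a_{+}$ for $t\in[0,\tau)$ and $a(t)=-a_{-}$ for $t\in[\tau,T)$. Let $g\colon(0,+\infty)\to(0,+\infty)$ be a continuous function. Let $\mathcal{O}$, $\mathcal{M}_{\mathrm{I}}$, $\mathcal{M}_{\mathrm{II}}$ be as defined in the context. Then there exists a pair $(\omega,\sigma)\in\mathcal{O}$ which solves $$\begin{cases}\mathcal{M}_{\mathrm{I}}(\omega,\sigma)=\tau,\\ \mathcal{M}_{\mathrm{II}}(\omega,\sigma)=T-\tau,\end{cases}$$ if and only if the Neumann boundary value problem $$\bigl(\phi(u')\bigr)'+a(t)g(u)=0 \ \text{ on } [0,T],\qquad u'(0)=u'(T)=0,$$ has a positive solution. Moreover, the unique solvability in $\mathcal{O}$ of the system $\mathcal{M}_{\mathrm{I}}(\omega,\sigma)=\tau$, $\mathcal{M}_{\mathrm{II}}(\omega,\sigma)=T-\tau$ (existence of exactly one pair $(\omega,\sigma)\in\mathcal{O}$ solving it) is equivalent to the uniqueness of the positive solution of the Neumann problem (existence of exactly one positive solution).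
   Context: A positive solution of $(\phi(u'))'+a(t)g(u)=0$ is a function $u\colon[0,T]\to(0,+\infty)$ of class $\mathcal{C}^{1}$ (with $u'$ taking values in $\Omega$) such that $\phi(u')$ is absolutely continuous and the equation is satisfied for almost every $t\in[0,T]$. Notation. Set $h=\phi^{-1}\colon\mathbb{R}\to\Omega$ and $H(y)=\int_{0}^{y}h(s)\,\mathrm{d}s$. Let $H_{l}:=H|_{(-\infty,0]}$, which is strictly monotone and hence invertible. Let $G\colon(0,+\infty)\to\mathbb{R}$ be a primitive of $g$ (strictly increasing, hence invertible onto its image), normalized as follows: if $\lim_{x\to0^{+}}G(x)$ is finite, then $G$ is chosen with $\lim_{x\to 0^{+}}G(x)=0$; if $\lim_{x\to0^{+}}G(x)=-\infty$ and $\lim_{x\to+\infty}G(x)$ is finite, then $G$ is chosen with $\lim_{x\to+\infty}G(x)=0$; if $\lim_{x\to0^{+}}G(x)=-\infty$ and $\lim_{x\to+\infty}G(x)=+\infty$, $G$ is any primitive. Set $$\mathcal{L}_{h}=h\circ H_{l}^{-1},\qquad \mathcal{L}_{g}=g\circ G^{-1},\qquad \mu=\frac{a_{+}}{a_{+}+a_{-}},$$ $$\mathcal{O}=\{(\omega,\sigma)\in G((0,+\infty))\times G((0,+\infty)) : \omega>\sigma\},$$ and define $\mathcal{M}_{\mathrm{I}},\mathcal{M}_{\mathrm{II}}\colon\mathcal{O}\to(0,+\infty)$ by $$\mathcal{M}_{\mathrm{I}}(\omega,\sigma)=\int_{\mu\omega+(1-\mu)\sigma}^{\omega}\frac{\mathrm{d}\vartheta}{-\mathcal{L}_{h}(a_{+}\omega-a_{+}\vartheta)\,\mathcal{L}_{g}(\vartheta)},$$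 $$\mathcal{M}_{\mathrm{II}}(\omega,\sigma)=\int_{\sigma}^{\mu\omega+(1-\mu)\sigma}\frac{\mathrm{d}\vartheta}{-\mathcal{L}_{h}(a_{-}\vartheta-a_{-}\sigma)\,\mathcal{L}_{g}(\vartheta)}.$$ *)

theory Defs
  imports "HOL-Analysis.Analysis"
begin

definition absolutely_continuous_on_interval :: "real \<Rightarrow> real \<Rightarrow> (real \<Rightarrow> real) \<Rightarrow> bool" where
  "absolutely_continuous_on_interval a b f \<longleftrightarrow>
     (\<forall>\<epsilon>>0. \<exists>\<delta>>0. \<forall>I :: (real \<times> real) set.
        finite I \<and> (\<forall>(x, y)\<in>I. a \<le> x \<and> x \<le> y \<and> y \<le> b) \<and>
        disjoint_family_on (\<lambda>(x, y). {x<..<y}) I \<and> (\<Sum>(x, y)\<in>I. y - x) < \<delta>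
        \<longrightarrow> (\<Sum>(x, y)\<in>I. \<bar>f y - f x\<bar>) < \<epsilon>)"

(* Solutions are functions with domain exactly [0,T], hence the extensional function space:
   off [0,T] they take the fixed value undefined, so that equality of solutions as HOL
   functions is equality on [0,T]. Derivatives are one-sided at 0 and at T. *)
definition positive_solution ::
  "real set \<Rightarrow> (real \<Rightarrow> real) \<Rightarrow> (real \<Rightarrow> real) \<Rightarrow> (real \<Rightarrow> real) \<Rightarrow> real \<Rightarrow> (real \<Rightarrow> real) \<Rightarrow> bool" where
  "positive_solution \<Omega> \<phi> a g T u \<longleftrightarrow>
     u \<in> {0..T} \<rightarrow>\<^sub>E {0<..} \<and>
     (\<exists>u'. (\<forall>t\<in>{0..T}. (u has_real_derivative u' t) (at t within {0..T})) \<and>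
           continuous_on {0..T} u' \<and>
           u' ` {0..T} \<subseteq> \<Omega> \<and>
           absolutely_continuous_on_interval 0 T (\<lambda>t. \<phi> (u' t)) \<and>
           (AE t\<in>{0..T} in lebesgue. \<exists>w.
              ((\<lambda>s. \<phi> (u' s)) has_real_derivative w) (at t within {0..T}) \<and>
              w + a t * g (u t) = 0))"

definition neumann_positive_solution ::
  "real set \<Rightarrow> (real \<Rightarrow> real) \<Rightarrow> (real \<Rightarrow> real) \<Rightarrow> (real \<Rightarrow> real) \<Rightarrow> real \<Rightarrow> (real \<Rightarrow> real) \<Rightarrow> bool" where
  "neumann_positive_solution \<Omega> \<phi> a g T u \<longleftrightarrow>
     positive_solution \<Omega> \<phi> a g T u \<and>
     (u has_real_derivative 0) (at 0 within {0..T}) \<and>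
     (u has_real_derivative 0) (at T within {0..T})"

(* The interval integral is oriented, so H h y = - (integral of h over [y,0]) for y < 0. *)
definition H :: "(real \<Rightarrow> real) \<Rightarrow> real \<Rightarrow> real" where
  "H h y = (LBINT s=0..y. h s)"

definition L_h :: "(real \<Rightarrow> real) \<Rightarrow> real \<Rightarrow> real" where
  "L_h h = h \<circ> inv_into {..0} (H h)"

(* If both one-sided limits of G are infinite, any primitive is admitted. The limit at 0 from
   the right cannot be infinite and positive, since G is increasing for positive g. *)
definition normalized_primitive :: "(real \<Rightarrow> real) \<Rightarrow> (real \<Rightarrow> real) \<Rightarrow> bool" where
  "normalized_primitive g G \<longleftrightarrow>
     (\<forall>x>0. (G has_real_derivative g x) (at x)) \<and>
     ((\<exists>l. (G \<longlongrightarrow> l) (at_right 0)) \<longrightarrow> (G \<longlongrightarrow> 0) (at_right 0)) \<and>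
     (filterlim G at_bot (at_right 0) \<and> (\<exists>l. (G \<longlongrightarrow> l) at_top) \<longrightarrow> (G \<longlongrightarrow> 0) at_top)"

definition L_g :: "(real \<Rightarrow> real) \<Rightarrow> (real \<Rightarrow> real) \<Rightarrow> real \<Rightarrow> real" where
  "L_g g G = g \<circ> inv_into {0<..} G"

definition \<mu> :: "real \<Rightarrow> real \<Rightarrow> real" where
  "\<mu> ap am = ap / (ap + am)"

definition \<O> :: "(real \<Rightarrow> real) \<Rightarrow> (real \<times> real) set" where
  "\<O> G = {(\<omega>, \<sigma>). \<omega> \<in> G ` {0<..} \<and> \<sigma> \<in> G ` {0<..} \<and> \<omega> > \<sigma>}"

(* In both integrals L_h vanishes at one endpoint only, so the convention 1 / 0 = 0 affects the
   integrand at a single point. *)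
definition M_I ::
  "(real \<Rightarrow> real) \<Rightarrow> (real \<Rightarrow> real) \<Rightarrow> (real \<Rightarrow> real) \<Rightarrow> real \<Rightarrow> real \<Rightarrow> real \<Rightarrow> real \<Rightarrow> real" where
  "M_I h g G ap am \<omega> \<sigma> =
     (LBINT \<theta>=\<mu> ap am * \<omega> + (1 - \<mu> ap am) * \<sigma>..\<omega>.
        1 / (- L_h h (ap * \<omega> - ap * \<theta>) * L_g g G \<theta>))"

definition M_II ::
  "(real \<Rightarrow> real) \<Rightarrow> (real \<Rightarrow> real) \<Rightarrow> (real \<Rightarrow> real) \<Rightarrow> real \<Rightarrow> real \<Rightarrow> real \<Rightarrow> real \<Rightarrow> real" where
  "M_II h g G ap am \<omega> \<sigma> =
     (LBINT \<theta>=\<sigma>..\<mu> ap am * \<omega> + (1 - \<mu> ap am) * \<sigma>.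
        1 / (- L_h h (am * \<theta> - am * \<sigma>) * L_g g G \<theta>))"

end

theory Submission
  imports Defs
begin

text \<open>
  Write \<open>y = \<phi> (u')\<close>. The equation becomes the planar system \<open>u' = h y\<close>, \<open>y' = - a g u\<close>, which is
  autonomous and Hamiltonian on \<open>[0, \<tau>]\<close> and on \<open>[\<tau>, T]\<close> separately: \<open>H y + ap G u\<close> is conserved on
  the first interval and \<open>H y - am G u\<close> on the second. The Neumann conditions say that \<open>y\<close> vanishes at
  both ends, so the two conserved quantities are \<open>ap \<omega>\<close> and \<open>- am \<sigma>\<close> with \<open>\<omega> = G (u 0)\<close> and
  \<open>\<sigma> = G (u T)\<close>. In between \<open>y\<close> first decreases and then increases, hence it is negative, and
  equating the two energies at \<open>\<tau>\<close> gives \<open>G (u \<tau>) = \<mu> \<omega> + (1 - \<mu>) \<sigma>\<close>.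

  On each interval \<open>\<theta> = G (u t)\<close> is strictly monotone and satisfies
  \<open>\<theta>' = L_g \<theta> * L_h (energy difference)\<close>, so the length of the interval is the integral of
  \<open>1 / \<bar>\<theta>'\<bar>\<close> with respect to \<open>\<theta>\<close>, which is \<open>M_I\<close> or \<open>M_II\<close> (lemma \<open>arc_time\<close>). Thus the levels of a
  solution solve the system.

  Run backwards from \<open>T\<close>, the second half of a solution has the same shape as the first
  half, up to one sign \<open>\<epsilon>\<close>: it starts with \<open>y = 0\<close> and \<open>y\<close> decreases. One analysis of such arcs
  therefore serves both halves. Solving the energy relation for \<open>u\<close> leaves the scalar equation
  \<open>y' = - p g (u)\<close> with \<open>u\<close> a function of \<open>y\<close>; its right-hand side is continuous and nowhere zero, up
  to and including \<open>y = 0\<close> where the integrals \<open>M_I\<close> and \<open>M_II\<close> are singular. Separation of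
  variables therefore gives existence and uniqueness of arcs with prescribed end levels
  (\<open>arc_exists\<close>, \<open>arc_unique\<close>). Given a solution of the system, the arcs built from it have durations
  \<open>M_I = \<tau>\<close> and \<open>M_II = T - \<tau>\<close>, by \<open>arc_time\<close> applied to the arcs themselves, and they glue to
  a solution of the boundary value problem. Hence \<open>u \<mapsto> (G (u 0), G (u T))\<close> is a bijection between the
  positive solutions of the Neumann problem and the solutions of the system, which yields
  both equivalences at once.

  Since solutions satisfy the equation only almost everywhere, the argument first needs that an
  absolutely continuous function whose derivative agrees almost everywhere with a continuous
  function has that derivative at every point (\<open>AC_interval_continuous_derivative\<close>).
\<close>

section \<open>Absolutely continuous functions with a continuous derivative\<close>

lemma AC_interval_subinterval:
  assumes "absolutely_continuous_on_interval a b f" "a \<le> c" "d \<le> b"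
  shows "absolutely_continuous_on_interval c d f"
  unfolding absolutely_continuous_on_interval_def
proof (intro allI impI)
  fix e :: real assume "e > 0"
  then obtain D where D: "D > 0" "\<forall>I :: (real \<times> real) set.
        finite I \<and> (\<forall>(x, y)\<in>I. a \<le> x \<and> x \<le> y \<and> y \<le> b) \<and>
        disjoint_family_on (\<lambda>(x, y). {x<..<y}) I \<and> (\<Sum>(x, y)\<in>I. y - x) < D
        \<longrightarrow> (\<Sum>(x, y)\<in>I. \<bar>f y - f x\<bar>) < e"
    using assms(1) unfolding absolutely_continuous_on_interval_def by meson
  show "\<exists>\<delta>>0. \<forall>I :: (real \<times> real) set.
        finite I \<and> (\<forall>(x, y)\<in>I. c \<le> x \<and> x \<le> y \<and> y \<le> d) \<and>
        disjoint_family_on (\<lambda>(x, y). {x<..<y}) I \<and> (\<Sum>(x, y)\<in>I. y - x) < \<delta>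
        \<longrightarrow> (\<Sum>(x, y)\<in>I. \<bar>f y - f x\<bar>) < e"
  proof (intro exI[of _ D] conjI allI impI)
    fix I :: "(real \<times> real) set"
    assume I: "finite I \<and> (\<forall>(x, y)\<in>I. c \<le> x \<and> x \<le> y \<and> y \<le> d) \<and>
        disjoint_family_on (\<lambda>(x, y). {x<..<y}) I \<and> (\<Sum>(x, y)\<in>I. y - x) < D"
    then have "\<forall>(x, y)\<in>I. a \<le> x \<and> x \<le> y \<and> y \<le> b"
      using assms(2,3) by fastforce
    with I D(2) show "(\<Sum>(x, y)\<in>I. \<bar>f y - f x\<bar>) < e" by blast
  qed (fact D(1))
qed

lemma lipschitz_imp_AC_interval:
  assumes "C-lipschitz_on {a..b} f"
  shows "absolutely_continuous_on_interval a b f"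
  unfolding absolutely_continuous_on_interval_def
proof (intro allI impI)
  fix e :: real assume e: "e > 0"
  have C: "C \<ge> 0" using assms by (rule lipschitz_on_nonneg)
  show "\<exists>\<delta>>0. \<forall>I :: (real \<times> real) set.
        finite I \<and> (\<forall>(x, y)\<in>I. a \<le> x \<and> x \<le> y \<and> y \<le> b) \<and>
        disjoint_family_on (\<lambda>(x, y). {x<..<y}) I \<and> (\<Sum>(x, y)\<in>I. y - x) < \<delta>
        \<longrightarrow> (\<Sum>(x, y)\<in>I. \<bar>f y - f x\<bar>) < e"
  proof (intro exI[of _ "e / (C + 1)"] conjI allI impI)
    show "e / (C + 1) > 0" using e C by simp
    fix I :: "(real \<times> real) set"
    assume I: "finite I \<and> (\<forall>(x, y)\<in>I. a \<le> x \<and> x \<le> y \<and> y \<le> b) \<and>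
        disjoint_family_on (\<lambda>(x, y). {x<..<y}) I \<and> (\<Sum>(x, y)\<in>I. y - x) < e / (C + 1)"
    have "(\<Sum>(x, y)\<in>I. \<bar>f y - f x\<bar>) \<le> (\<Sum>(x, y)\<in>I. (C + 1) * (y - x))"
    proof (intro sum_mono, clarify)
      fix x y assume "(x, y) \<in> I"
      then have xy: "a \<le> x" "x \<le> y" "y \<le> b" using I by auto
      have "\<bar>f y - f x\<bar> \<le> C * \<bar>y - x\<bar>"
        using lipschitz_onD[OF assms, of y x] xy by (simp add: dist_real_def)
      also have "\<dots> \<le> (C + 1) * (y - x)" using xy by (simp add: algebra_simps)
      finally show "\<bar>f y - f x\<bar> \<le> (C + 1) * (y - x)" .
    qed
    also have "\<dots> = (C + 1) * (\<Sum>(x, y)\<in>I. y - x)"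
      by (simp add: sum_distrib_left case_prod_unfold)
    also have "\<dots> < (C + 1) * (e / (C + 1))"
      using I C by (intro mult_strict_left_mono) auto
    also have "\<dots> = e" using C by simp
    finally show "(\<Sum>(x, y)\<in>I. \<bar>f y - f x\<bar>) < e" .
  qed
qed

text \<open>
  Take a tagged division fine enough that intervals tagged at a point with derivative zero
  change \<open>f\<close> by at most \<open>e\<close> times their length, while intervals tagged in the exceptional null set lie in
  an open set of measure below the \<open>\<delta>\<close> of absolute continuity and so change \<open>f\<close> by less than \<open>e\<close> in
  total.
\<close>
lemma AC_interval_zero_derivative:
  assumes AC: "absolutely_continuous_on_interval a b f" and "a \<le> b"
    and ae: "AE t\<in>{a..b} in lebesgue. (f has_real_derivative 0) (at t within {a..b})"
  shows "f b = f a"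
proof -
  have est: "\<bar>f b - f a\<bar> \<le> e * (1 + (b - a))" if e: "e > 0" for e
  proof -
    obtain D where D: "D > 0" "\<And>I :: (real \<times> real) set. \<lbrakk>finite I; \<forall>(x, y)\<in>I. a \<le> x \<and> x \<le> y \<and> y \<le> b;
        disjoint_family_on (\<lambda>(x, y). {x<..<y}) I; (\<Sum>(x, y)\<in>I. y - x) < D\<rbrakk>
        \<Longrightarrow> (\<Sum>(x, y)\<in>I. \<bar>f y - f x\<bar>) < e"
      using AC e unfolding absolutely_continuous_on_interval_def by meson
    obtain N where N: "N \<in> null_sets lebesgue"
      "{t. \<not> (t \<in> {a..b} \<longrightarrow> (f has_real_derivative 0) (at t within {a..b}))} \<subseteq> N"
      using ae unfolding eventually_ae_filter by auto
    have "N \<in> sets lebesgue" using N(1) by blast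
    then obtain U where U: "open U" "N \<subseteq> U" "emeasure lebesgue (U - N) < ennreal D"
      using D(1) by (rule sets_lebesgue_outer_open)
    have "U \<in> sets lebesgue" using U(1) by (intro sets_completionI_sets) simp
    then have emU: "emeasure lebesgue U < ennreal D"
      using U(3) emeasure_Diff_null_set[OF N(1)] by simp
    have "\<exists>d>0. \<forall>s\<in>{a..b}. \<bar>s - t\<bar> < d \<longrightarrow> \<bar>f s - f t\<bar> \<le> e * \<bar>s - t\<bar>" if "t \<in> {a..b} - N" for t
    proof -
      have "(f has_real_derivative 0) (at t within {a..b})" using N(2) that by blast
      then show ?thesis
        using e unfolding has_field_derivative_def has_derivative_within_alt by auto
    qed
    then obtain d where d: "\<And>t. t \<in> {a..b} - N \<Longrightarrow> d t > 0"
      "\<And>t s. t \<in> {a..b} - N \<Longrightarrow> s \<in> {a..b} \<Longrightarrow> \<bar>s - t\<bar> < d t \<Longrightarrow> \<bar>f s - f t\<bar> \<le> e * \<bar>s - t\<bar>"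
      by metis
    define \<gamma> where "\<gamma> t = (if t \<in> N then U else if t \<in> {a..b} then ball t (d t) else UNIV)" for t
    have "gauge \<gamma>" using U d(1) by (auto simp: gauge_def \<gamma>_def)
    then obtain p where p: "p tagged_division_of {a..b}" "\<gamma> fine p"
      by (rule fine_division_exists_real)
    have K: "\<exists>u v. K = {u..v} \<and> u \<le> t \<and> t \<le> v \<and> a \<le> u \<and> v \<le> b \<and> {u..v} \<subseteq> \<gamma> t" if tK: "(t, K) \<in> p" for t K
    proof -
      obtain u v where uv: "K = {u..v}" using tagged_division_ofD(4)[OF p(1) tK] by auto
      have "t \<in> K" "K \<subseteq> {a..b}" "K \<subseteq> \<gamma> t"
        using tagged_division_ofD(2,3)[OF p(1) tK] p(2) tK by (auto simp: fine_def)
      with uv show ?thesis by auto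
    qed
    have fin: "finite p" using p(1) by (rule tagged_division_of_finite)
    \<comment> \<open>Degenerate intervals contribute nothing. The others have disjoint nonempty interiors, so
      that each is determined by its end points, as absolute continuity speaks of end points only.\<close>
    define q where "q = {(t, K) \<in> p. t \<in> N \<and> Inf K < Sup K}"
    define ends :: "real \<times> real set \<Rightarrow> real \<times> real" where "ends = (\<lambda>(t, K). (Inf K, Sup K))"
    have qp: "q \<subseteq> p" by (auto simp: q_def)
    have disj: "{Inf K<..<Sup K} \<inter> {Inf K'<..<Sup K'} = {}"
      if "(t, K) \<in> p" "(t', K') \<in> p" "(t, K) \<noteq> (t', K')" for t K t' K'
      using tagged_division_ofD(5)[OF p(1) that] K[OF that(1)] K[OF that(2)] by auto
    have inj: "inj_on ends q"
    proof (rule inj_onI, clarify)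
      fix t K t' K' assume *: "(t, K) \<in> q" "(t', K') \<in> q" "ends (t, K) = ends (t', K')"
      then have "{Inf K<..<Sup K} \<inter> {Inf K'<..<Sup K'} \<noteq> {}"
        by (auto simp: q_def ends_def dest: dense)
      then show "t = t' \<and> K = K'" using disj[of t K t' K'] * qp by auto
    qed
    have disjI: "disjoint_family_on (\<lambda>(x, y). {x<..<y}) (ends ` q)"
      unfolding disjoint_family_on_def using disj qp by (fastforce simp: ends_def)
    have "(\<Sum>(x, y)\<in>ends ` q. \<bar>f y - f x\<bar>) < e"
    proof (rule D(2))
      show "finite (ends ` q)" using fin qp by (simp add: finite_subset)
      show "\<forall>(x, y)\<in>ends ` q. a \<le> x \<and> x \<le> y \<and> y \<le> b"
        using K qp by (fastforce simp: ends_def)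
      show "disjoint_family_on (\<lambda>(x, y). {x<..<y}) (ends ` q)" by (fact disjI)
      have "ennreal (\<Sum>(x, y)\<in>ends ` q. y - x) = (\<Sum>i\<in>ends ` q. emeasure lebesgue (case i of (x, y) \<Rightarrow> {x<..<y}))"
        by (subst sum_ennreal[symmetric]) (auto simp: q_def ends_def intro!: sum.cong)
      also have "\<dots> = emeasure lebesgue (\<Union>i\<in>ends ` q. case i of (x, y) \<Rightarrow> {x<..<y})"
        by (rule sum_emeasure[OF _ disjI]) (use fin qp in \<open>auto intro: finite_subset\<close>)
      also have "\<dots> \<le> emeasure lebesgue U"
      proof (rule emeasure_mono)
        show "(\<Union>i\<in>ends ` q. case i of (x, y) \<Rightarrow> {x<..<y}) \<subseteq> U"
          using K by (fastforce simp: ends_def q_def \<gamma>_def)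
      qed (use U(1) in auto)
      also note emU
      finally have "ennreal (\<Sum>(x, y)\<in>ends ` q. y - x) < ennreal D" .
      moreover have "(\<Sum>(x, y)\<in>ends ` q. y - x) \<ge> 0"
        by (rule sum_nonneg) (auto simp: q_def ends_def)
      ultimately show "(\<Sum>(x, y)\<in>ends ` q. y - x) < D"
        by (simp add: ennreal_less_iff)
    qed
    then have bad: "(\<Sum>(t, K)\<in>q. \<bar>f (Sup K) - f (Inf K)\<bar>) < e"
      unfolding sum.reindex[OF inj] by (simp add: ends_def case_prod_unfold o_def)
    have good: "\<bar>f (Sup K) - f (Inf K)\<bar> \<le> e * (Sup K - Inf K)" if tK: "(t, K) \<in> p - q" for t K
    proof -
      obtain u v where uv: "K = {u..v}" "u \<le> t" "t \<le> v" "a \<le> u" "v \<le> b" "{u..v} \<subseteq> \<gamma> t"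
        using K tK by blast
      show ?thesis
      proof (cases "u = v")
        case False
        then have "t \<in> {a..b} - N" using tK uv by (auto simp: q_def)
        moreover from this have "\<gamma> t = ball t (d t)" by (auto simp: \<gamma>_def)
        moreover have "u \<in> {u..v}" "v \<in> {u..v}" using uv by auto
        ultimately have "t \<in> {a..b} - N" "u \<in> ball t (d t)" "v \<in> ball t (d t)"
          using uv(6) by auto
        then have "\<bar>f u - f t\<bar> \<le> e * \<bar>u - t\<bar>" "\<bar>f v - f t\<bar> \<le> e * \<bar>v - t\<bar>"
          using d(2)[of t u] d(2)[of t v] uv by (auto simp: dist_real_def)
        with uv show ?thesis by (simp add: algebra_simps)
      qed (use uv in auto)
    qed
    have "\<bar>f b - f a\<bar> = \<bar>\<Sum>(t, K)\<in>p. f (Sup K) - f (Inf K)\<bar>"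
      using additive_tagged_division_1[OF \<open>a \<le> b\<close> p(1), of f] by simp
    also have "\<dots> \<le> (\<Sum>(t, K)\<in>p. \<bar>f (Sup K) - f (Inf K)\<bar>)"
      using sum_abs[of "\<lambda>(t, K). f (Sup K) - f (Inf K)" p] by (simp add: case_prod_unfold)
    also have "\<dots> = (\<Sum>(t, K)\<in>p - q. \<bar>f (Sup K) - f (Inf K)\<bar>) + (\<Sum>(t, K)\<in>q. \<bar>f (Sup K) - f (Inf K)\<bar>)"
      by (rule sum.subset_diff[OF qp fin])
    also have "(\<Sum>(t, K)\<in>p - q. \<bar>f (Sup K) - f (Inf K)\<bar>) \<le> (\<Sum>(t, K)\<in>p - q. e * (Sup K - Inf K))"
      using good by (intro sum_mono) auto
    also have "\<dots> \<le> (\<Sum>(t, K)\<in>p. e * (Sup K - Inf K))"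
    proof (rule sum_mono2)
      fix i assume "i \<in> p - (p - q)"
      then show "(case i of (t, K) \<Rightarrow> e * (Sup K - Inf K)) \<ge> 0"
        using e by (auto simp: q_def)
    qed (use fin in auto)
    also have "\<dots> = e * (b - a)"
      using additive_tagged_division_1[OF \<open>a \<le> b\<close> p(1), of "\<lambda>t. t"]
      by (simp add: sum_distrib_left[symmetric] case_prod_unfold)
    finally show ?thesis using bad by (simp add: algebra_simps)
  qed
  show ?thesis
  proof (rule ccontr)
    assume "f b \<noteq> f a"
    define c where "c = 1 + (b - a)"
    have c: "c > 0" using \<open>a \<le> b\<close> by (simp add: c_def)
    have "\<bar>f b - f a\<bar> \<le> \<bar>f b - f a\<bar> / (2 * c) * c"
      using est[of "\<bar>f b - f a\<bar> / (2 * c)"] c \<open>f b \<noteq> f a\<close> by (simp add: c_def)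
    also have "\<dots> = \<bar>f b - f a\<bar> / 2" using c by simp
    finally have "\<bar>f b - f a\<bar> \<le> \<bar>f b - f a\<bar> / 2" .
    with \<open>f b \<noteq> f a\<close> show False by simp
  qed
qed

lemma AC_interval_diff:
  assumes f: "absolutely_continuous_on_interval a b f"
    and k: "absolutely_continuous_on_interval a b k"
  shows "absolutely_continuous_on_interval a b (\<lambda>t. f t - k t)"
  unfolding absolutely_continuous_on_interval_def
proof (intro allI impI)
  fix e :: real assume "e > 0"
  then have e2: "e / 2 > 0" by simp
  obtain D where D: "D > 0" "\<And>I :: (real \<times> real) set. \<lbrakk>finite I; \<forall>(x, y)\<in>I. a \<le> x \<and> x \<le> y \<and> y \<le> b;
        disjoint_family_on (\<lambda>(x, y). {x<..<y}) I; (\<Sum>(x, y)\<in>I. y - x) < D\<rbrakk>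
        \<Longrightarrow> (\<Sum>(x, y)\<in>I. \<bar>f y - f x\<bar>) < e / 2"
    using f e2 unfolding absolutely_continuous_on_interval_def by meson
  obtain D' where D': "D' > 0" "\<And>I :: (real \<times> real) set. \<lbrakk>finite I; \<forall>(x, y)\<in>I. a \<le> x \<and> x \<le> y \<and> y \<le> b;
        disjoint_family_on (\<lambda>(x, y). {x<..<y}) I; (\<Sum>(x, y)\<in>I. y - x) < D'\<rbrakk>
        \<Longrightarrow> (\<Sum>(x, y)\<in>I. \<bar>k y - k x\<bar>) < e / 2"
    using k e2 unfolding absolutely_continuous_on_interval_def by meson
  show "\<exists>\<delta>>0. \<forall>I :: (real \<times> real) set.
        finite I \<and> (\<forall>(x, y)\<in>I. a \<le> x \<and> x \<le> y \<and> y \<le> b) \<and>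
        disjoint_family_on (\<lambda>(x, y). {x<..<y}) I \<and> (\<Sum>(x, y)\<in>I. y - x) < \<delta>
        \<longrightarrow> (\<Sum>(x, y)\<in>I. \<bar>(f y - k y) - (f x - k x)\<bar>) < e"
  proof (intro exI[of _ "min D D'"] conjI allI impI)
    show "min D D' > 0" using D D' by simp
    fix I :: "(real \<times> real) set"
    assume I: "finite I \<and> (\<forall>(x, y)\<in>I. a \<le> x \<and> x \<le> y \<and> y \<le> b) \<and>
        disjoint_family_on (\<lambda>(x, y). {x<..<y}) I \<and> (\<Sum>(x, y)\<in>I. y - x) < min D D'"
    have "(\<Sum>(x, y)\<in>I. \<bar>(f y - k y) - (f x - k x)\<bar>)
        \<le> (\<Sum>(x, y)\<in>I. \<bar>f y - f x\<bar> + \<bar>k y - k x\<bar>)"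
      by (intro sum_mono) auto
    also have "\<dots> = (\<Sum>(x, y)\<in>I. \<bar>f y - f x\<bar>) + (\<Sum>(x, y)\<in>I. \<bar>k y - k x\<bar>)"
      by (simp add: sum.distrib case_prod_unfold)
    also have "\<dots> < e / 2 + e / 2"
      using D(2)[of I] D'(2)[of I] I by (intro add_strict_mono) auto
    finally show "(\<Sum>(x, y)\<in>I. \<bar>(f y - k y) - (f x - k x)\<bar>) < e" by simp
  qed
qed

lemma lipschitz_on_continuous_derivative:
  fixes f :: "real \<Rightarrow> real"
  assumes "\<And>t. t \<in> {a..b} \<Longrightarrow> (f has_real_derivative k t) (at t within {a..b})"
    and "continuous_on {a..b} k"
  obtains C where "C-lipschitz_on {a..b} f"
proof -
  have "bounded (k ` {a..b})" using assms(2) by (intro compact_imp_bounded compact_continuous_image) auto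
  then obtain C where C: "C > 0" "\<And>t. t \<in> {a..b} \<Longrightarrow> norm (k t) \<le> C"
    by (auto simp: bounded_pos)
  show ?thesis
  proof (rule that, rule bounded_derivative_imp_lipschitz)
    show "(f has_derivative (*) (k t)) (at t within {a..b})" if "t \<in> {a..b}" for t
      using assms(1)[OF that] by (simp add: has_field_derivative_def)
    show "onorm ((*) (k t)) \<le> C" if "t \<in> {a..b}" for t
      using C(2)[OF that] by (intro onorm_le) (auto simp: abs_mult mult_right_mono)
  qed (use C(1) in auto)
qed

text \<open>
  Subtracting the primitive of the continuous function \<open>k\<close> reduces the claim to derivative zero.
\<close>
lemma AC_interval_continuous_derivative:
  assumes AC: "absolutely_continuous_on_interval a b f" and k: "continuous_on {a..b} k"
    and ae: "AE t\<in>{a..b} in lebesgue. (f has_real_derivative k t) (at t within {a..b})"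
    and t: "t \<in> {a..b}"
  shows "(f has_real_derivative k t) (at t within {a..b})"
proof -
  let ?P = "\<lambda>s. integral {a..s} k"
  have P: "(?P has_real_derivative k s) (at s within {a..b})" if "s \<in> {a..b}" for s
    using k that by (rule integral_has_real_derivative)
  obtain C where "C-lipschitz_on {a..b} ?P"
    using P k by (rule lipschitz_on_continuous_derivative) auto
  then have ACw: "absolutely_continuous_on_interval a b (\<lambda>s. f s - ?P s)"
    by (rule AC_interval_diff[OF AC lipschitz_imp_AC_interval])
  have eq: "f s = f a + ?P s" if s: "s \<in> {a..b}" for s
  proof -
    have "(\<lambda>s. f s - ?P s) s = (\<lambda>s. f s - ?P s) a"
    proof (rule AC_interval_zero_derivative[OF AC_interval_subinterval[OF ACw]])
      show "AE t\<in>{a..s} in lebesgue. ((\<lambda>s. f s - ?P s) has_real_derivative 0) (at t within {a..s})"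
        using ae
      proof eventually_elim
        case (elim r)
        show ?case
        proof
          assume "r \<in> {a..s}"
          then have "r \<in> {a..b}" using s by auto
          then have "((\<lambda>s. f s - ?P s) has_real_derivative k r - k r) (at r within {a..b})"
            using elim P by (intro DERIV_diff) auto
          then show "((\<lambda>s. f s - ?P s) has_real_derivative 0) (at r within {a..s})"
            using s by (auto elim: DERIV_subset)
        qed
      qed
    qed (use s in auto)
    then show ?thesis by simp
  qed
  have "((\<lambda>s. f a + ?P s) has_real_derivative k t) (at t within {a..b})"
    using DERIV_add[OF DERIV_const P[OF t]] by simp
  then show ?thesis
    by (rule has_field_derivative_transform_within[where d = 1]) (use t in \<open>simp_all add: eq[symmetric]\<close>)
qed

text \<open>
  This glues derivatives at a junction point. Closedness makes the statement hold at all other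
  points too: away from a closed set the filter within it is trivial.
\<close>
lemma has_real_derivative_closed_Un:
  fixes f :: "real \<Rightarrow> real"
  assumes "closed S" "closed S'" "t \<in> S \<union> S'"
    and "t \<in> S \<Longrightarrow> (f has_real_derivative D) (at t within S)"
    and "t \<in> S' \<Longrightarrow> (f has_real_derivative D) (at t within S')"
  shows "(f has_real_derivative D) (at t within S \<union> S')"
proof -
  have out: "(f has_real_derivative D) (at t within X)" if "closed X" "t \<notin> X" for X
  proof -
    have "at t within X = bot" using that by (metis closed_limpt trivial_limit_within)
    then show ?thesis by (simp add: has_field_derivative_iff)
  qed
  have "(f has_real_derivative D) (at t within S)" "(f has_real_derivative D) (at t within S')"
    using assms out by blast+
  then show ?thesis
    unfolding has_field_derivative_iff unfolding at_within_union by (rule filterlim_sup)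
qed

section \<open>Autonomous scalar equations with a positive right-hand side\<close>

text \<open>
  Separation of variables: \<open>v\<close> is the inverse of \<open>N y = \<integral> 1 / f\<close> from \<open>0\<close> to \<open>y\<close>. Positivity
  of \<open>f\<close> makes \<open>N\<close> strictly increasing with a nonvanishing derivative.
\<close>
lemma autonomous_ode_exists:
  fixes f :: "real \<Rightarrow> real"
  assumes b: "b > 0" and cont: "continuous_on {0..b} f" and pos: "\<And>s. s \<in> {0..b} \<Longrightarrow> f s > 0"
  obtains L v where "L > 0" "v 0 = 0" "v L = b" "\<And>t. t \<in> {0..L} \<Longrightarrow> v t \<in> {0..b}"
    "\<And>t. t \<in> {0..L} \<Longrightarrow> (v has_real_derivative f (v t)) (at t within {0..L})"
proof -
  \<comment> \<open>Extending \<open>f\<close> by constants beyond both ends makes \<open>0\<close> and \<open>b\<close> interior points, so that the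
    inverse function theorem applies there.\<close>
  define F where "F s = f (max 0 (min b s))" for s
  have Fpos: "F s > 0" for s using pos[of "max 0 (min b s)"] b by (simp add: F_def)
  have "continuous_on UNIV (f \<circ> (\<lambda>s. max 0 (min b s)))"
    by (intro continuous_on_compose continuous_intros continuous_on_subset[OF cont]) (use b in auto)
  then have Fcont: "continuous_on A F" for A
    using continuous_on_subset[of UNIV F A] by (simp add: F_def[abs_def] o_def)
  define N where "N y = integral {-1..y} (\<lambda>s. 1 / F s) - integral {-1..0} (\<lambda>s. 1 / F s)" for y
  have N': "(N has_real_derivative 1 / F y) (at y)" if "-1 < y" "y < b + 1" for y
  proof -
    have "((\<lambda>y. integral {-1..y} (\<lambda>s. 1 / F s)) has_real_derivative 1 / F y) (at y within {-1..b + 1})"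
      by (rule integral_has_real_derivative) (use that Fcont Fpos in \<open>auto intro!: continuous_intros simp: less_imp_neq[symmetric]\<close>)
    then show ?thesis
      using that unfolding N_def at_within_Icc_at[OF that] by (auto intro!: derivative_eq_intros)
  qed
  have Ncont: "isCont N y" if "-1 < y" "y < b + 1" for y
    using N'[OF that] by (rule DERIV_isCont)
  have Nless: "N y < N z" if "-1 < y" "y < z" "z < b + 1" for y z
  proof (rule DERIV_pos_imp_increasing[OF that(2)])
    fix s assume "y \<le> s" "s \<le> z"
    then show "\<exists>D. (N has_real_derivative D) (at s) \<and> 0 < D"
      using N'[of s] Fpos[of s] that by (intro exI[of _ "1 / F s"]) auto
  qed
  have Ninj: "inj_on N {-1<..<b + 1}"
    by (rule linorder_inj_onI) (use Nless in force)+
  define v where "v = inv_into {-1<..<b + 1} N"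
  have vN: "v (N y) = y" if "-1 < y" "y < b + 1" for y
    unfolding v_def by (rule inv_into_f_f[OF Ninj]) (use that in auto)
  have ivt: "\<exists>y\<in>{c..d}. N y = t" if "-1 < c" "c \<le> d" "d < b + 1" "N c \<le> t" "t \<le> N d" for c d t
    using IVT[of N c t d] Ncont that by auto
  have N0: "N 0 = 0" by (simp add: N_def)
  have vin: "v t \<in> {0..b}" if "t \<in> {0..N b}" for t
    using ivt[of 0 b t] that N0 b vN by auto
  show ?thesis
  proof
    show "N b > 0" using Nless[of 0 b] N0 b by simp
    show "v 0 = 0" using vN[of 0] N0 b by simp
    show "v (N b) = b" using vN[of b] b by simp
    fix t assume t: "t \<in> {0..N b}"
    show vt: "v t \<in> {0..b}" using vin t .
    obtain y where y: "y \<in> {0..b}" "t = N y" using ivt[of 0 b t] t N0 b by auto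
    have vy: "v t = y" using y vN by auto
    have "isCont v (N y)"
      by (rule isCont_inverse_function2[of "-1/2" y "b + 1/2"]) (use y b vN Ncont in auto)
    then have "(v has_real_derivative inverse (1 / F y)) (at (N y))"
    proof (rule DERIV_inverse_function[where a = "N (-1/2)" and b = "N (b + 1/2)", rotated 5])
      show "(N has_real_derivative 1 / F y) (at (v (N y)))" using N'[of y] y vy by simp
      show "1 / F y \<noteq> 0" using Fpos[of y] by simp
      show "N (-1/2) < N y" "N y < N (b + 1/2)" using Nless y b by auto
      fix s assume "N (-1/2) < s" "s < N (b + 1/2)"
      then show "N (v s) = s" using ivt[of "-1/2" "b + 1/2" s] b vN by auto
    qed
    moreover have "F y = f y" using y by (simp add: F_def)
    ultimately show "(v has_real_derivative f (v t)) (at t within {0..N b})"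
      using y vy by (auto intro: has_field_derivative_at_within)
  qed
qed

lemma autonomous_ode_time:
  fixes f :: "real \<Rightarrow> real"
  assumes cont: "continuous_on {0..b} f" and pos: "\<And>s. s \<in> {0..b} \<Longrightarrow> f s > 0"
    and v: "v 0 = 0" "\<And>t. t \<in> {0..L} \<Longrightarrow> v t \<in> {0..b}"
      "\<And>t. t \<in> {0..L} \<Longrightarrow> (v has_real_derivative f (v t)) (at t within {0..L})"
    and t: "t \<in> {0..L}"
  shows "integral {0..v t} (\<lambda>s. 1 / f s) = t"
proof -
  let ?N = "\<lambda>y. integral {0..y} (\<lambda>s. 1 / f s)"
  have N': "(?N has_real_derivative 1 / f y) (at y within {0..b})" if "y \<in> {0..b}" for y
    by (rule integral_has_real_derivative) (use that cont pos in \<open>force intro!: continuous_intros\<close>)+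
  have "((\<lambda>t. ?N (v t) - t) has_real_derivative 0) (at t within {0..L})" if "t \<in> {0..L}" for t
  proof -
    have "(?N has_real_derivative 1 / f (v t)) (at (v t) within v ` {0..L})"
      by (rule DERIV_subset[OF N'[OF v(2)[OF that]]]) (use v(2) in auto)
    from DERIV_image_chain[OF this v(3)[OF that]]
    have "((\<lambda>t. ?N (v t)) has_real_derivative 1) (at t within {0..L})"
      using pos[OF v(2)[OF that]] by (simp add: o_def)
    then show ?thesis by (auto intro!: derivative_eq_intros)
  qed
  then obtain c where c: "\<And>t. t \<in> {0..L} \<Longrightarrow> ?N (v t) - t = c"
    using has_field_derivative_zero_constant[of "{0..L}" "\<lambda>t. ?N (v t) - t"] by auto
  have "c = 0" using c[of 0] t v(1) by simp
  with c[OF t] show ?thesis by simp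
qed

lemma autonomous_ode_unique:
  fixes f :: "real \<Rightarrow> real"
  assumes cont: "continuous_on {0..b} f" and pos: "\<And>s. s \<in> {0..b} \<Longrightarrow> f s > 0"
    and v: "v 0 = 0" "\<And>t. t \<in> {0..L} \<Longrightarrow> v t \<in> {0..b}"
      "\<And>t. t \<in> {0..L} \<Longrightarrow> (v has_real_derivative f (v t)) (at t within {0..L})"
    and w: "w 0 = 0" "\<And>t. t \<in> {0..L} \<Longrightarrow> w t \<in> {0..b}"
      "\<And>t. t \<in> {0..L} \<Longrightarrow> (w has_real_derivative f (w t)) (at t within {0..L})"
    and t: "t \<in> {0..L}"
  shows "v t = w t"
proof -
  have no: "False" if yz: "0 \<le> y" "y < z" "z \<le> b"
      and eq: "integral {0..y} (\<lambda>s. 1 / f s) = integral {0..z} (\<lambda>s. 1 / f s)" for y z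
  proof -
    have N': "((\<lambda>y. integral {0..y} (\<lambda>s. 1 / f s)) has_real_derivative 1 / f s) (at s within {0..b})"
      if "s \<in> {0..b}" for s
      by (rule integral_has_real_derivative) (use that cont pos in \<open>force intro!: continuous_intros\<close>)+
    have "integral {0..y} (\<lambda>s. 1 / f s) < integral {0..z} (\<lambda>s. 1 / f s)"
    proof (rule DERIV_pos_imp_increasing_open[OF yz(2)])
      fix s assume s: "y < s" "s < z"
      then have "((\<lambda>y. integral {0..y} (\<lambda>s. 1 / f s)) has_real_derivative 1 / f s) (at s)"
        using N'[of s] yz at_within_Icc_at[of 0 s b] by auto
      then show "\<exists>D. ((\<lambda>y. integral {0..y} (\<lambda>s. 1 / f s)) has_real_derivative D) (at s) \<and> 0 < D"
        using pos[of s] s yz by (intro exI[of _ "1 / f s"]) auto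
    next
      show "continuous_on {y..z} (\<lambda>y. integral {0..y} (\<lambda>s. 1 / f s))"
        by (rule continuous_on_subset[OF DERIV_continuous_on[OF N']]) (use yz in auto)
    qed
    with eq show False by simp
  qed
  have "integral {0..v t} (\<lambda>s. 1 / f s) = integral {0..w t} (\<lambda>s. 1 / f s)"
    using autonomous_ode_time[OF cont pos v t] autonomous_ode_time[OF cont pos w t] by simp
  then show ?thesis
    using no[of "v t" "w t"] no[of "w t" "v t"] v(2)[OF t] w(2)[OF t]
    by (cases "v t" "w t" rule: linorder_cases) auto
qed

section \<open>Kinetic and potential energy\<close>

text \<open>
  \<open>H h\<close> is the kinetic and \<open>G\<close> the potential energy. Both are strictly monotone on the relevant half
  line, so that \<open>L_h h\<close> and \<open>L_g g G\<close> recover the velocity and the force from the respective energy.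
\<close>
locale energy_quadrature =
  fixes h g G :: "real \<Rightarrow> real"
  assumes h_cont: "continuous_on UNIV h" and h_mono: "strict_mono h" and h_0: "h 0 = 0"
    and g_cont: "continuous_on {0<..} g" and g_pos: "\<And>x. x > 0 \<Longrightarrow> g x > 0"
    and G_deriv: "\<And>x. x > 0 \<Longrightarrow> (G has_real_derivative g x) (at x)"
begin

lemma h_neg: "y < 0 \<Longrightarrow> h y < 0"
  using strict_monoD[OF h_mono, of y 0] h_0 by simp

lemma h_nonpos: "y \<le> 0 \<Longrightarrow> h y \<le> 0"
  using h_neg[of y] h_0 by (cases "y = 0") auto

lemma H_deriv: "(H h has_real_derivative h y) (at y)"
proof -
  define a where "a = - \<bar>y\<bar> - 1"
  define b where "b = \<bar>y\<bar> + 1"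
  have ab: "a < y" "y < b" "a \<le> 0" "0 \<le> b" by (auto simp: a_def b_def)
  have "((\<lambda>u. LBINT s=ereal 0..ereal u. h s) has_vector_derivative h y) (at y within {a..b})"
    by (rule interval_integral_FTC2) (use ab h_cont in \<open>auto intro: continuous_on_subset\<close>)
  then show ?thesis
    using ab at_within_Icc_at[of a y b]
    by (simp add: H_def[abs_def] has_real_derivative_iff_has_vector_derivative zero_ereal_def)
qed

lemma H_cont: "isCont (H h) y"
  using H_deriv by (rule DERIV_isCont)

lemma H_0: "H h 0 = 0"
  by (simp add: H_def zero_ereal_def)

lemma H_less:
  assumes "y < z" "z \<le> 0"
  shows "H h z < H h y"
proof (rule DERIV_neg_imp_decreasing_open[OF assms(1)])
  show "continuous_on {y..z} (H h)" using H_cont by (simp add: continuous_at_imp_continuous_on)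
  fix s assume "y < s" "s < z"
  then show "\<exists>D. (H h has_real_derivative D) (at s) \<and> D < 0"
    using H_deriv h_neg assms by (intro exI[of _ "h s"]) auto
qed

lemma H_inj: "inj_on (H h) {..0}"
proof (rule linorder_inj_onI)
  show "H h y \<noteq> H h z" if "y < z" "y \<in> {..0}" "z \<in> {..0}" for y z
    using H_less[of y z] that by simp
qed auto

lemma H_le: "y \<le> z \<Longrightarrow> z \<le> 0 \<Longrightarrow> H h z \<le> H h y"
  using H_less[of y z] by (cases "y = z") auto

text \<open>
  Below \<open>-1\<close> the slope of \<open>H h\<close> is at most \<open>h (-1) < 0\<close>, so \<open>H h\<close> is unbounded on the negative half line.
\<close>
lemma H_surj:
  assumes "s \<ge> 0"
  obtains y where "y \<le> 0" "H h y = s"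
proof -
  define k where "k = - h (-1)"
  have k: "k > 0" using h_neg[of "-1"] by (simp add: k_def)
  define y where "y = -1 - s / k"
  have y: "y \<le> -1" using assms k by (simp add: y_def)
  have "H h y + k * y \<ge> H h (-1) + k * (-1)"
  proof (rule DERIV_nonpos_imp_nonincreasing[OF y])
    fix z :: real assume "z \<le> -1"
    then have "h z + k \<le> 0" using strict_mono_leD[OF h_mono, of z "-1"] by (simp add: k_def)
    moreover have "((\<lambda>y. H h y + k * y) has_real_derivative h z + k) (at z)"
      by (auto intro!: derivative_eq_intros H_deriv)
    ultimately show "\<exists>D. ((\<lambda>y. H h y + k * y) has_real_derivative D) (at z) \<and> D \<le> 0" by blast
  qed
  moreover have "k * y = - k - s" using k by (simp add: y_def field_simps)
  moreover have "H h (-1) > 0" using H_less[of "-1" 0] H_0 by simp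
  ultimately have "H h y \<ge> s" by simp
  then obtain z where "y \<le> z" "z \<le> 0" "H h z = s"
    using IVT2[of "H h" 0 s y] H_cont H_0 assms y by auto
  then show ?thesis using that by blast
qed

lemma L_h_H: "y \<le> 0 \<Longrightarrow> L_h h (H h y) = h y"
  by (simp add: L_h_def inv_into_f_f[OF H_inj])

lemma isCont_L_h:
  assumes "y < 0"
  shows "isCont (L_h h) (H h y)"
  unfolding L_h_def
proof (rule continuous_at_compose)
  show "isCont (inv_into {..0} (H h)) (H h y)"
    by (rule isCont_inverse_function2[of "y - 1" y 0])
       (use assms H_cont inv_into_f_f[OF H_inj] in auto)
  show "isCont h (inv_into {..0} (H h) (H h y))"
    using h_cont by (simp add: continuous_on_eq_continuous_at)
qed

lemma G_cont: "x > 0 \<Longrightarrow> isCont G x"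
  using G_deriv by (rule DERIV_isCont)

lemma G_less:
  assumes "0 < x" "x < x'"
  shows "G x < G x'"
proof (rule DERIV_pos_imp_increasing[OF assms(2)])
  fix z assume "x \<le> z"
  then show "\<exists>D. (G has_real_derivative D) (at z) \<and> 0 < D"
    using G_deriv[of z] g_pos[of z] assms(1) by auto
qed

lemma G_inj: "inj_on G {0<..}"
proof (rule linorder_inj_onI)
  show "G x \<noteq> G x'" if "x < x'" "x \<in> {0<..}" "x' \<in> {0<..}" for x x'
    using G_less[of x x'] that by simp
qed auto

lemma G_ivt:
  assumes "0 < x" "0 < x'" "w \<in> closed_segment (G x) (G x')"
  obtains z where "z > 0" "G z = w"
proof -
  have *: "\<exists>z>0. G z = w" if "0 < x" "x \<le> x'" "G x \<le> w" "w \<le> G x'" for x x'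
  proof -
    have "\<exists>z\<ge>x. z \<le> x' \<and> G z = w" using that G_cont by (intro IVT) auto
    then obtain z where "z \<ge> x" "G z = w" by blast
    then show ?thesis using that(1) by (intro exI[of _ z]) auto
  qed
  have "\<exists>z>0. G z = w"
    using *[of x x'] *[of x' x] assms G_less[of x x'] G_less[of x' x]
    by (cases x x' rule: linorder_cases) (auto simp: closed_segment_eq_real_ivl split: if_splits)
  then show ?thesis using that by blast
qed

abbreviation Ginv :: "real \<Rightarrow> real" where
  "Ginv \<equiv> inv_into {0<..} G"

lemma Ginv_G: "x > 0 \<Longrightarrow> Ginv (G x) = x"
  by (simp add: inv_into_f_f[OF G_inj])

lemma L_g_G: "x > 0 \<Longrightarrow> L_g g G (G x) = g x"
  by (simp add: L_g_def Ginv_G)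

lemma isCont_Ginv: "x > 0 \<Longrightarrow> isCont Ginv (G x)"
  by (rule isCont_inverse_function2[of "x / 2" x "x + 1"]) (use G_cont Ginv_G in auto)

lemma isCont_g: "x > 0 \<Longrightarrow> isCont g x"
  using g_cont by (auto simp: continuous_on_eq_continuous_at)

lemma isCont_L_g: "x > 0 \<Longrightarrow> isCont (L_g g G) (G x)"
  unfolding L_g_def by (rule continuous_at_compose) (auto simp: isCont_Ginv Ginv_G isCont_g)

lemma Ginv_deriv:
  assumes "x > 0"
  shows "(Ginv has_real_derivative inverse (g x)) (at (G x))"
proof (rule DERIV_inverse_function[where a = "G (x / 2)" and b = "G (x + 1)"])
  show "(G has_real_derivative g x) (at (Ginv (G x)))" using assms G_deriv by (simp add: Ginv_G)
  show "g x \<noteq> 0" using g_pos[OF assms] by simp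
  show "G (x / 2) < G x" "G x < G (x + 1)" using G_less assms by auto
  show "isCont Ginv (G x)" using isCont_Ginv[OF assms] .
  fix w assume "G (x / 2) < w" "w < G (x + 1)"
  then obtain z where "z > 0" "G z = w"
    using G_ivt[of "x / 2" "x + 1" w] assms by (auto simp: closed_segment_eq_real_ivl)
  then show "G (Ginv w) = w" by (auto simp: Ginv_G)
qed

section \<open>Arcs\<close>

text \<open>
  One monotone half of a solution, measured from the end at which the Neumann condition holds. The
  first half is the case \<open>\<epsilon> = 1\<close>. In the second half time runs backwards from \<open>T\<close>: this reverses the
  sign in \<open>x' = h y\<close>, whereas in \<open>y' = - a g x\<close> it cancels against the negative sign of the weight.
  For \<open>p > 0\<close> the momentum \<open>y\<close> is negative after the start in both cases.
\<close>
definition arc :: "real \<Rightarrow> real \<Rightarrow> real \<Rightarrow> (real \<Rightarrow> real) \<Rightarrow> (real \<Rightarrow> real) \<Rightarrow> bool" where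
  "arc \<epsilon> p L x y \<longleftrightarrow> y 0 = 0 \<and> (\<forall>t\<in>{0..L}. x t > 0 \<and>
     (x has_real_derivative \<epsilon> * h (y t)) (at t within {0..L}) \<and>
     (y has_real_derivative - p * g (x t)) (at t within {0..L}))"

lemma arcD:
  assumes "arc \<epsilon> p L x y"
  shows "y 0 = 0" "t \<in> {0..L} \<Longrightarrow> x t > 0"
    "t \<in> {0..L} \<Longrightarrow> (x has_real_derivative \<epsilon> * h (y t)) (at t within {0..L})"
    "t \<in> {0..L} \<Longrightarrow> (y has_real_derivative - p * g (x t)) (at t within {0..L})"
  using assms by (auto simp: arc_def)

lemma arc_momentum_cont:
  assumes "arc \<epsilon> p L x y"
  shows "continuous_on {0..L} y"
  by (rule DERIV_continuous_on, rule arcD[OF assms], assumption)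

lemma arc_momentum_decreasing:
  assumes arc: "arc \<epsilon> p L x y" and p: "p > 0" and st: "0 \<le> s" "s < t" "t \<le> L"
  shows "y t < y s"
proof (rule DERIV_neg_imp_decreasing_open[OF st(2)])
  fix r assume r: "s < r" "r < t"
  then have "(y has_real_derivative - p * g (x r)) (at r)"
    using arcD(4)[OF arc, of r] st at_within_Icc_at[of 0 r L] by auto
  moreover have "- p * g (x r) < 0" using arcD(2)[OF arc, of r] g_pos p r st by simp
  ultimately show "\<exists>D. (y has_real_derivative D) (at r) \<and> D < 0" by blast
next
  show "continuous_on {s..t} y" using arc_momentum_cont[OF arc] by (rule continuous_on_subset) (use st in auto)
qed

lemma arc_momentum_neg:
  assumes "arc \<epsilon> p L x y" "p > 0" "0 < t" "t \<le> L"
  shows "y t < 0"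
  using arc_momentum_decreasing[OF assms(1,2), of 0 t] arcD(1)[OF assms(1)] assms by simp

lemma arc_energy:
  assumes arc: "arc \<epsilon> p L x y" and \<epsilon>: "\<epsilon> * \<epsilon> = 1" and t: "t \<in> {0..L}"
  shows "H h (y t) = p * (\<epsilon> * (G (x 0) - G (x t)))"
proof -
  let ?E = "\<lambda>t. H h (y t) + p * (\<epsilon> * G (x t))"
  have "(?E has_real_derivative 0) (at t within {0..L})" if t: "t \<in> {0..L}" for t
  proof -
    note a = arcD[OF arc]
    have "((\<lambda>t. H h (y t)) has_real_derivative h (y t) * (- p * g (x t))) (at t within {0..L})"
      using H_deriv a(4)[OF t] by (rule DERIV_chain2[where f = "H h" and g = y])
    moreover have "((\<lambda>t. G (x t)) has_real_derivative g (x t) * (\<epsilon> * h (y t))) (at t within {0..L})"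
      using G_deriv[OF a(2)[OF t]] a(3)[OF t] by (rule DERIV_chain2[where f = G and g = x])
    ultimately have "(?E has_real_derivative
        h (y t) * (- p * g (x t)) + p * (\<epsilon> * (g (x t) * (\<epsilon> * h (y t))))) (at t within {0..L})"
      by (intro DERIV_add DERIV_cmult)
    moreover have "h (y t) * (- p * g (x t)) + p * (\<epsilon> * (g (x t) * (\<epsilon> * h (y t)))) = 0"
      using \<epsilon> by algebra
    ultimately show ?thesis by (simp only:)
  qed
  then have "\<exists>c. \<forall>t\<in>{0..L}. ?E t = c"
    by (intro has_field_derivative_zero_constant) (rule convex_real_interval)
  then obtain c where c: "\<forall>t\<in>{0..L}. ?E t = c" ..
  have "?E t = ?E 0" using c[rule_format, of t] c[rule_format, of 0] t by simp
  then show ?thesis using arcD(1)[OF arc] H_0 by (simp add: algebra_simps)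
qed

lemma isCont_h: "isCont h y"
  using h_cont by (simp add: continuous_on_eq_continuous_at)

text \<open>
  Substituting \<open>\<theta> = \<Theta> t = - \<epsilon> G (x t)\<close> turns the integrand into \<open>1\<close>, because \<open>\<Theta>' t = - h (y t) g (x t)\<close> and the
  energy relation expresses \<open>h (y t)\<close> and \<open>g (x t)\<close> through \<open>\<theta>\<close>. The sign in \<open>\<Theta>\<close> makes the substitution
  increasing for both values of \<open>\<epsilon>\<close>. At \<open>t = 0\<close> the integrand is singular since \<open>h (y 0) = 0\<close>; a
  substitution rule on the open interval is therefore needed.
\<close>
lemma arc_time:
  assumes arc: "arc \<epsilon> p L x y" and \<epsilon>: "\<epsilon> * \<epsilon> = 1" and p: "p > 0" and L: "L > 0"
  shows "(LBINT \<theta>=- \<epsilon> * G (x 0)..- \<epsilon> * G (x L).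
           1 / (- L_h h (p * (\<epsilon> * G (x 0) + \<theta>)) * L_g g G (- \<epsilon> * \<theta>))) = L"
proof -
  define F where "F \<theta> = 1 / (- L_h h (p * (\<epsilon> * G (x 0) + \<theta>)) * L_g g G (- \<epsilon> * \<theta>))" for \<theta>
  define \<Theta> where "\<Theta> t = - \<epsilon> * G (x t)" for t
  define \<Theta>' where "\<Theta>' t = - (h (y t) * g (x t))" for t
  have xpos: "x t > 0" if "t \<in> {0..L}" for t using arcD(2)[OF arc that] .
  have ynonpos: "y t \<le> 0" if "t \<in> {0..L}" for t
    using arc_momentum_neg[OF arc p, of t] arcD(1)[OF arc] that by (cases "t = 0") auto
  have arg: "p * (\<epsilon> * G (x 0) + \<Theta> t) = H h (y t)" "- \<epsilon> * \<Theta> t = G (x t)" if "t \<in> {0..L}" for t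
  proof -
    show "p * (\<epsilon> * G (x 0) + \<Theta> t) = H h (y t)"
      unfolding arc_energy[OF arc \<epsilon> that] \<Theta>_def by (simp add: algebra_simps)
    have "- \<epsilon> * \<Theta> t = (\<epsilon> * \<epsilon>) * G (x t)" by (simp add: \<Theta>_def)
    then show "- \<epsilon> * \<Theta> t = G (x t)" by (simp add: \<epsilon>)
  qed
  have F\<Theta>: "F (\<Theta> t) = 1 / (- h (y t) * g (x t))" if "t \<in> {0..L}" for t
    using L_h_H[OF ynonpos[OF that]] L_g_G[OF xpos[OF that]] unfolding F_def arg[OF that] by simp
  have \<Theta>deriv: "(\<Theta> has_real_derivative \<Theta>' t) (at t within {0..L})" if t: "t \<in> {0..L}" for t
  proof -
    have "((\<lambda>t. G (x t)) has_real_derivative g (x t) * (\<epsilon> * h (y t))) (at t within {0..L})"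
      using G_deriv[OF xpos[OF t]] arcD(3)[OF arc t] by (rule DERIV_chain2[where f = G and g = x])
    then have "(\<Theta> has_real_derivative - \<epsilon> * (g (x t) * (\<epsilon> * h (y t)))) (at t within {0..L})"
      unfolding \<Theta>_def[abs_def] by (rule DERIV_cmult)
    moreover have "- \<epsilon> * (g (x t) * (\<epsilon> * h (y t))) = \<Theta>' t"
      unfolding \<Theta>'_def using \<epsilon> by algebra
    ultimately show ?thesis by (simp only:)
  qed
  have \<Theta>cont: "continuous_on {0..L} \<Theta>" using \<Theta>deriv by (rule DERIV_continuous_on)
  have unit: "F (\<Theta> t) * \<Theta>' t = 1" if "0 < t" "t < L" for t
    using F\<Theta>[of t] arc_momentum_neg[OF arc p, of t] h_neg[of "y t"] g_pos[OF xpos[of t]] that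
    by (simp add: \<Theta>'_def)
  have isC: "isCont x t" "isCont y t" if "0 < t" "t < L" for t
    using arcD(3,4)[OF arc, of t] that at_within_Icc_at[of 0 t L] by (auto intro: DERIV_isCont)
  have "(LBINT \<theta>=ereal (\<Theta> 0)..ereal (\<Theta> L). F \<theta>) = (LBINT t=ereal 0..ereal L. F (\<Theta> t) * \<Theta>' t)"
  proof (rule interval_integral_substitution_nonneg(2))
    show "ereal 0 < ereal L" using L by simp
    show "(\<Theta> has_real_derivative \<Theta>' t) (at t)" if "ereal 0 < ereal t" "ereal t < ereal L" for t
      using \<Theta>deriv[of t] that at_within_Icc_at[of 0 t L] by simp
    show "isCont F (\<Theta> t)" if "ereal 0 < ereal t" "ereal t < ereal L" for t
    proof -
      have t: "t \<in> {0..L}" and y: "y t < 0" using that arc_momentum_neg[OF arc p, of t] by auto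
      have "isCont (\<lambda>\<theta>. L_h h (p * (\<epsilon> * G (x 0) + \<theta>))) (\<Theta> t)"
        by (rule isCont_o2[where g = "L_h h"]) (auto simp only: arg[OF t] isCont_L_h[OF y] intro!: continuous_intros)
      moreover have "isCont (\<lambda>\<theta>. L_g g G (- \<epsilon> * \<theta>)) (\<Theta> t)"
        by (rule isCont_o2[where g = "L_g g G"]) (auto simp only: arg[OF t] isCont_L_g[OF xpos[OF t]] intro!: continuous_intros)
      moreover have "- L_h h (p * (\<epsilon> * G (x 0) + \<Theta> t)) * L_g g G (- \<epsilon> * \<Theta> t) \<noteq> 0"
        unfolding arg[OF t] using L_h_H[of "y t"] L_g_G[OF xpos[OF t]] h_neg[OF y] g_pos[OF xpos[OF t]] y by simp
      ultimately show ?thesis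
        unfolding F_def[abs_def] by (intro continuous_divide continuous_mult continuous_minus continuous_const) auto
    qed
    show "isCont \<Theta>' t" if "ereal 0 < ereal t" "ereal t < ereal L" for t
    proof -
      have t: "0 < t" "t < L" using that by auto
      have "isCont (\<lambda>t. h (y t)) t" by (rule isCont_o2[OF isC(2)[OF t] isCont_h])
      moreover have "isCont (\<lambda>t. g (x t)) t"
        by (rule isCont_o2[OF isC(1)[OF t] isCont_g[OF xpos]]) (use t in auto)
      ultimately show ?thesis unfolding \<Theta>'_def[abs_def] by (intro continuous_minus continuous_mult)
    qed
    show "0 \<le> F (\<Theta> t)" if "ereal 0 < ereal t" "ereal t < ereal L" for t
      using F\<Theta>[of t] that h_nonpos[OF ynonpos[of t]] g_pos[OF xpos[of t]]
      by (simp add: divide_nonneg_nonpos mult_nonpos_nonneg)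
    show "0 \<le> \<Theta>' t" if "ereal 0 \<le> ereal t" "ereal t \<le> ereal L" for t
      using that h_nonpos[OF ynonpos[of t]] g_pos[OF xpos[of t]] by (simp add: \<Theta>'_def mult_nonpos_nonneg)
    show "((ereal \<circ> \<Theta> \<circ> real_of_ereal) \<longlongrightarrow> ereal (\<Theta> 0)) (at_right (ereal 0))"
      unfolding ereal_tendsto_simps by (rule continuous_on_Icc_at_rightD[OF \<Theta>cont L])
    show "((ereal \<circ> \<Theta> \<circ> real_of_ereal) \<longlongrightarrow> ereal (\<Theta> L)) (at_left (ereal L))"
      unfolding ereal_tendsto_simps by (rule continuous_on_Icc_at_leftD[OF \<Theta>cont L])
    have "set_integrable lborel (einterval (ereal 0) (ereal L)) (\<lambda>t. 1 :: real)"
      using interval_integral_const(1)[of 0 L "1 :: real"] L by (simp add: interval_lebesgue_integrable_def)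
    then show "set_integrable lborel (einterval (ereal 0) (ereal L)) (\<lambda>t. F (\<Theta> t) * \<Theta>' t)"
      by (rule set_integrable_cong[THEN iffD1, rotated -1]) (auto simp: unit einterval_def)
  qed
  also have "\<dots> = (LBINT t=ereal 0..ereal L. 1)"
    by (rule interval_integral_cong) (use L unit in \<open>auto simp: einterval_def\<close>)
  also have "\<dots> = L" by (subst interval_integral_const) simp
  finally show ?thesis unfolding F_def \<Theta>_def .
qed

lemma arc_time_forward:
  assumes "arc 1 p L x y" "p > 0" "L > 0"
  shows "(LBINT \<theta>=G (x L)..G (x 0). 1 / (- L_h h (p * G (x 0) - p * \<theta>) * L_g g G \<theta>)) = L"
  using arc_time[OF assms(1) _ assms(2,3)]
  by (subst interval_integral_reflect) (simp add: algebra_simps)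

lemma arc_time_backward:
  assumes "arc (- 1) p L x y" "p > 0" "L > 0"
  shows "(LBINT \<theta>=G (x 0)..G (x L). 1 / (- L_h h (p * \<theta> - p * G (x 0)) * L_g g G \<theta>)) = L"
  using arc_time[OF assms(1) _ assms(2,3)] by (simp add: algebra_simps)

text \<open>
  The kinetic energy at momentum \<open>- s\<close> lies between \<open>0\<close> and its value at \<open>- b\<close>, so the potential energy that
  the energy relation assigns to it lies between \<open>G x0\<close> and \<open>G x1\<close> and hence in the range of \<open>G\<close>.
\<close>
lemma energy_level:
  assumes x: "x0 > 0" "x1 > 0" and \<epsilon>: "\<epsilon> * \<epsilon> = 1" and p: "p > 0"
    and b: "H h (- b) = p * (\<epsilon> * (G x0 - G x1))" and s: "s \<in> {0..b}"
  obtains z where "z > 0" "G z = G x0 - \<epsilon> * H h (- s) / p"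
proof -
  define w where "w = G x0 - \<epsilon> * H h (- s) / p"
  have Hs: "0 \<le> H h (- s)" "H h (- s) \<le> H h (- b)" using H_le[of "- s" 0] H_le[of "- b" "- s"] H_0 s by auto
  have eb: "\<epsilon> * H h (- b) / p = G x0 - G x1"
    using p \<epsilon> by (simp add: b)
  consider "\<epsilon> = 1" | "\<epsilon> = -1" using \<epsilon> by (metis square_eq_1_iff)
  then have "w \<in> closed_segment (G x0) (G x1)"
  proof cases
    case 1
    have "0 \<le> H h (- s) / p" "H h (- s) / p \<le> H h (- b) / p" using Hs p by (auto simp: divide_right_mono)
    with 1 eb show ?thesis by (auto simp: w_def closed_segment_eq_real_ivl)
  next
    case 2
    have "0 \<le> H h (- s) / p" "H h (- s) / p \<le> H h (- b) / p" using Hs p by (auto simp: divide_right_mono)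
    with 2 eb show ?thesis by (auto simp: w_def closed_segment_eq_real_ivl)
  qed
  then show ?thesis using G_ivt[OF x] that unfolding w_def by blast
qed

text \<open>
  The position at which an arc that starts at rest in \<open>x0\<close> has momentum \<open>- s\<close>: the energy relation
  solved for the position.
\<close>
definition level :: "real \<Rightarrow> real \<Rightarrow> real \<Rightarrow> real \<Rightarrow> real" where
  "level \<epsilon> p x0 s = Ginv (G x0 - \<epsilon> * H h (- s) / p)"

lemma level:
  assumes "x0 > 0" "x1 > 0" "\<epsilon> * \<epsilon> = 1" "p > 0"
    and "H h (- b) = p * (\<epsilon> * (G x0 - G x1))" and "s \<in> {0..b}"
  shows level_pos: "level \<epsilon> p x0 s > 0"
    and G_level: "G (level \<epsilon> p x0 s) = G x0 - \<epsilon> * H h (- s) / p"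
    and level_deriv: "(level \<epsilon> p x0 has_real_derivative \<epsilon> * h (- s) / (p * g (level \<epsilon> p x0 s))) (at s)"
proof -
  obtain z where z: "z > 0" "G z = G x0 - \<epsilon> * H h (- s) / p"
    using energy_level[OF assms] .
  then have lz: "level \<epsilon> p x0 s = z" by (simp add: level_def flip: z(2)) (simp add: Ginv_G)
  show "level \<epsilon> p x0 s > 0" "G (level \<epsilon> p x0 s) = G x0 - \<epsilon> * H h (- s) / p" using z lz by auto
  have "((\<lambda>s. H h (- s)) has_real_derivative h (- s) * (- 1)) (at s)"
    by (rule DERIV_chain2[where f = "H h" and g = uminus]) (auto intro!: derivative_eq_intros H_deriv)
  then have 1: "((\<lambda>s. G x0 - \<epsilon> * H h (- s) / p) has_real_derivative \<epsilon> * h (- s) / p) (at s)"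
    using assms(4) by (auto intro!: derivative_eq_intros)
  have 2: "(Ginv has_real_derivative inverse (g z)) (at (G x0 - \<epsilon> * H h (- s) / p))"
    using Ginv_deriv[OF z(1)] by (simp only: z(2))
  from DERIV_chain2[where f = Ginv, OF 2 1]
  show "(level \<epsilon> p x0 has_real_derivative \<epsilon> * h (- s) / (p * g (level \<epsilon> p x0 s))) (at s)"
    unfolding lz by (simp add: level_def[abs_def] divide_inverse mult_ac)
qed

lemma level_speed_cont:
  assumes "x0 > 0" "x1 > 0" "\<epsilon> * \<epsilon> = 1" "p > 0"
    and "H h (- b) = p * (\<epsilon> * (G x0 - G x1))"
  shows "continuous_on {0..b} (\<lambda>s. p * g (level \<epsilon> p x0 s))"
proof (intro continuous_at_imp_continuous_on ballI continuous_mult continuous_const)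
  fix s assume "s \<in> {0..b}"
  note l = level[OF assms this]
  show "isCont (\<lambda>s. g (level \<epsilon> p x0 s)) s"
    using DERIV_isCont[OF l(3)] isCont_g[OF l(1)] by (rule isCont_o2)
qed

text \<open>
  Along an arc the positive quantity \<open>v = - y\<close> satisfies the closed equation \<open>v' = p g (level v)\<close>.
  Conversely a solution \<open>v\<close> of it gives the arc \<open>x = level v\<close>, \<open>y = - v\<close>.
\<close>
lemma arc_exists:
  assumes x: "x0 > 0" "x1 > 0" and \<epsilon>: "\<epsilon> * \<epsilon> = 1" and p: "p > 0" and b: "b > 0"
    and Hb: "H h (- b) = p * (\<epsilon> * (G x0 - G x1))"
  obtains L x y where "L > 0" "arc \<epsilon> p L x y" "x 0 = x0" "x L = x1" "y L = - b"
proof -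
  note l = level[OF x \<epsilon> p Hb]
  obtain L v where v: "L > 0" "v 0 = 0" "v L = b" "\<And>t. t \<in> {0..L} \<Longrightarrow> v t \<in> {0..b}"
    "\<And>t. t \<in> {0..L} \<Longrightarrow> (v has_real_derivative p * g (level \<epsilon> p x0 (v t))) (at t within {0..L})"
    by (rule autonomous_ode_exists[OF b level_speed_cont[OF x \<epsilon> p Hb]]) (use l(1) g_pos p in auto)
  show ?thesis
  proof
    show "L > 0" by fact
    show "level \<epsilon> p x0 (v 0) = x0" using x by (simp add: v level_def H_0 Ginv_G)
    have "G (level \<epsilon> p x0 b) = G x1"
      using l(2)[of b] b p \<epsilon> by (simp add: Hb) (metis add_diff_cancel_left' diff_add_cancel mult.assoc mult_1 diff_diff_eq2)
    then show "level \<epsilon> p x0 (v L) = x1"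
      using inj_onD[OF G_inj] l(1)[of b] b x v(3) by simp
    show "- v L = - b" using v by simp
    show "arc \<epsilon> p L (\<lambda>t. level \<epsilon> p x0 (v t)) (\<lambda>t. - v t)"
      unfolding arc_def
    proof (intro conjI ballI)
      fix t assume t: "t \<in> {0..L}"
      note lt = l[OF v(4)[OF t]]
      show "level \<epsilon> p x0 (v t) > 0" by (fact lt(1))
      have "\<epsilon> * h (- v t) / (p * g (level \<epsilon> p x0 (v t))) * (p * g (level \<epsilon> p x0 (v t))) = \<epsilon> * h (- v t)"
        using p g_pos[OF lt(1)] by simp
      with DERIV_chain2[where f = "level \<epsilon> p x0", OF lt(3) v(5)[OF t]]
      show "((\<lambda>t. level \<epsilon> p x0 (v t)) has_real_derivative \<epsilon> * h (- v t)) (at t within {0..L})"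
        by (simp only:)
      show "((\<lambda>t. - v t) has_real_derivative - p * g (level \<epsilon> p x0 (v t))) (at t within {0..L})"
        using DERIV_minus[OF v(5)[OF t]] by simp
    qed (use v in simp)
  qed
qed

text \<open>
  Both arcs are governed by the same scalar equation for \<open>- y\<close>. The common end level
  confines both momenta to one interval on which the right-hand side of that equation is defined.
\<close>
lemma arc_unique:
  assumes a: "arc \<epsilon> p L x y" and a': "arc \<epsilon> p L x' y'" and \<epsilon>: "\<epsilon> * \<epsilon> = 1" and p: "p > 0" and L: "L > 0"
    and eq: "x 0 = x' 0" "x L = x' L" and t: "t \<in> {0..L}"
  shows "x t = x' t"
proof -
  define b where "b = - y L"
  have L0: "0 \<in> {0..L}" "L \<in> {0..L}" using L by auto
  have pos: "x 0 > 0" "x L > 0" using arcD(2)[OF a] L0 by auto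
  have Hb: "H h (- b) = p * (\<epsilon> * (G (x 0) - G (x L)))" using arc_energy[OF a \<epsilon> L0(2)] by (simp add: b_def)
  have neg: "y L < 0" "y' L < 0" using arc_momentum_neg[OF a p L] arc_momentum_neg[OF a' p L] by auto
  have "H h (y L) = H h (y' L)" using arc_energy[OF a \<epsilon> L0(2)] arc_energy[OF a' \<epsilon> L0(2)] eq by simp
  then have b': "b = - y' L" using inj_onD[OF H_inj, of "y L" "y' L"] neg by (simp add: b_def)
  note l = level[OF pos \<epsilon> p Hb]
  have main: "- w t \<in> {0..b} \<and> z t = level \<epsilon> p (x 0) (- w t)
      \<and> ((\<lambda>t. - w t) has_real_derivative p * g (level \<epsilon> p (x 0) (- w t))) (at t within {0..L})"
    if arc: "arc \<epsilon> p L z w" and z0: "z 0 = x 0" and wL: "b = - w L" and t: "t \<in> {0..L}" for z w t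
  proof -
    have w0: "w t \<le> 0"
      using arc_momentum_neg[OF arc p, of t] arcD(1)[OF arc] t by (cases "t = 0") auto
    moreover have "w L \<le> w t" using arc_momentum_decreasing[OF arc p, of t L] t by (cases "t = L") auto
    moreover have "z t = level \<epsilon> p (x 0) (- w t)"
    proof -
      have "\<epsilon> * H h (w t) = \<epsilon> * (p * (\<epsilon> * (G (x 0) - G (z t))))"
        using arc_energy[OF arc \<epsilon> t] z0 by simp
      also have "\<dots> = p * (G (x 0) - G (z t))" using \<epsilon> by algebra
      finally have "\<epsilon> * H h (w t) / p = G (x 0) - G (z t)" using p by simp
      then show ?thesis using arcD(2)[OF arc t] by (simp add: level_def Ginv_G)
    qed
    ultimately show ?thesis using DERIV_minus[OF arcD(4)[OF arc t]] wL by auto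
  qed
  note m = main[OF a refl b_def] and m' = main[OF a' eq(1)[symmetric] b']
  have speed_pos: "p * g (level \<epsilon> p (x 0) s) > 0" if "s \<in> {0..b}" for s
    using l(1)[OF that] g_pos p by simp
  have "- y 0 = 0" "- y' 0 = 0" using arcD(1)[OF a] arcD(1)[OF a'] by auto
  then have "- y t = - y' t"
    using autonomous_ode_unique[OF level_speed_cont[OF pos \<epsilon> p Hb] speed_pos,
        where v = "\<lambda>t. - y t" and w = "\<lambda>t. - y' t" and L = L and t = t] m m' t by blast
  with m[OF t] m'[OF t] show ?thesis by simp
qed

end

section \<open>One-sided derivatives\<close>

lemma has_real_derivative_Icc_unique:
  fixes f :: "real \<Rightarrow> real"
  assumes "(f has_real_derivative D) (at t within {a..b})" "(f has_real_derivative D') (at t within {a..b})"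
    and "a < b" "t \<in> {a..b}"
  shows "D = D'"
proof -
  have "t islimpt {a..b}" using assms(3,4) by (simp add: islimpt_Icc)
  then have "at t within {a..b} \<noteq> bot" by (simp add: trivial_limit_within)
  then show ?thesis
    using assms(1,2) unfolding has_field_derivative_iff by (rule tendsto_unique)
qed

lemma has_real_derivative_time_reversal:
  fixes f :: "real \<Rightarrow> real"
  assumes "(f has_real_derivative D) (at (T - t) within S)" "(\<lambda>s. T - s) ` S' \<subseteq> S"
  shows "((\<lambda>s. f (T - s)) has_real_derivative - D) (at t within S')"
proof -
  have "(f has_real_derivative D) (at (T - t) within (\<lambda>s. T - s) ` S')"
    using assms by (rule DERIV_subset)
  moreover have "((\<lambda>s. T - s) has_real_derivative - 1) (at t within S')"
    by (auto intro!: derivative_eq_intros)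
  ultimately show ?thesis using DERIV_image_chain[of f D "\<lambda>s. T - s" t S' "- 1"] by (simp add: o_def)
qed

section \<open>Solutions of the Neumann problem as pairs of arcs\<close>

locale indefinite_neumann =
  fixes \<Omega> :: "real set" and \<phi> h g G a :: "real \<Rightarrow> real" and \<tau> T ap am :: real
  assumes zero_in: "0 \<in> \<Omega>"
    and homeo: "homeomorphism \<Omega> UNIV \<phi> h" and \<phi>_0: "\<phi> 0 = 0" and \<phi>_sign: "\<And>s. s \<in> \<Omega> - {0} \<Longrightarrow> \<phi> s * s > 0"
    and \<tau>: "0 < \<tau>" "\<tau> < T"
    and weights: "ap > 0" "am > 0"
    and a: "\<And>t. t \<in> {0..<\<tau>} \<Longrightarrow> a t = ap" "\<And>t. t \<in> {\<tau>..<T} \<Longrightarrow> a t = - am"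
    and g: "continuous_on {0<..} g" "\<And>x. x > 0 \<Longrightarrow> g x > 0"
    and G': "\<And>x. x > 0 \<Longrightarrow> (G has_real_derivative g x) (at x)"
begin

lemma \<phi>_h: "\<phi> (h y) = y" and h_in: "h y \<in> \<Omega>" and h_\<phi>: "s \<in> \<Omega> \<Longrightarrow> h (\<phi> s) = s"
  using homeo by (auto simp: homeomorphism_def)

sublocale energy_quadrature h g G
proof
  show hc: "continuous_on UNIV h" using homeo by (simp add: homeomorphism_def)
  show h0: "h 0 = 0" using h_\<phi>[OF zero_in] \<phi>_0 by simp
  have "inj h" using \<phi>_h by (metis injI)
  then have "strict_mono_on UNIV h \<or> strict_antimono_on UNIV h"
    using injective_eq_monotone_map[of UNIV h] hc by simp
  moreover have "\<not> strict_antimono_on UNIV h"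
  proof
    assume "strict_antimono_on UNIV h"
    then have "h 1 < h 0" by (auto simp: monotone_on_def)
    then show False using h0 \<phi>_sign[of "h 1"] h_in[of 1] \<phi>_h[of 1] by simp
  qed
  ultimately show "strict_mono h" by simp
qed (use g G' in auto)

abbreviation solution :: "(real \<Rightarrow> real) \<Rightarrow> bool" where
  "solution \<equiv> neumann_positive_solution \<Omega> \<phi> a g T"

text \<open>
  The weight is constant on each of the two intervals, so the derivative prescribed there almost
  everywhere is continuous and is attained at every point, one-sidedly at \<open>\<tau>\<close>.
\<close>
lemma solution_imp_arcs:
  assumes "solution u"
  obtains y where "arc 1 ap \<tau> u y" "arc (- 1) am (T - \<tau>) (\<lambda>s. u (T - s)) (\<lambda>s. y (T - s))"
proof -
  obtain u' where upos: "u \<in> {0..T} \<rightarrow>\<^sub>E {0<..}"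
    and u'_ball: "\<forall>t\<in>{0..T}. (u has_real_derivative u' t) (at t within {0..T})"
    and u'_in: "u' ` {0..T} \<subseteq> \<Omega>"
    and AC: "absolutely_continuous_on_interval 0 T (\<lambda>t. \<phi> (u' t))"
    and ae: "AE t\<in>{0..T} in lebesgue. \<exists>w. ((\<lambda>s. \<phi> (u' s)) has_real_derivative w) (at t within {0..T}) \<and>
              w + a t * g (u t) = 0"
    and bc: "(u has_real_derivative 0) (at 0 within {0..T})" "(u has_real_derivative 0) (at T within {0..T})"
    using assms unfolding neumann_positive_solution_def positive_solution_def by blast
  have u': "(u has_real_derivative u' t) (at t within {0..T})" if "t \<in> {0..T}" for t
    using u'_ball that by blast
  have pos: "u t > 0" if "t \<in> {0..T}" for t using PiE_mem[OF upos that] by simp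
  define y where "y t = \<phi> (u' t)" for t
  have hy: "h (y t) = u' t" if "t \<in> {0..T}" for t
  proof -
    have "u' t \<in> \<Omega>" using u'_in that by blast
    then show ?thesis by (simp add: y_def h_\<phi>)
  qed
  have y0: "y 0 = 0" "y T = 0"
    using has_real_derivative_Icc_unique[OF u' bc(1)] has_real_derivative_Icc_unique[OF u' bc(2)] \<tau> \<phi>_0
    by (auto simp: y_def)
  have ucont: "continuous_on {0..T} u" using u' by (rule DERIV_continuous_on)
  have gu: "continuous_on {0..T} (\<lambda>t. g (u t))"
    by (rule continuous_on_compose2[OF g(1) ucont]) (use pos in auto)
  have piece: "(y has_real_derivative k * g (u t)) (at t within {c..d})"
    if cd: "0 \<le> c" "d \<le> T" and ak: "\<And>t. t \<in> {c..<d} \<Longrightarrow> a t = - k" and t: "t \<in> {c..d}" for c d k t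
  proof (rule AC_interval_continuous_derivative[OF _ _ _ t])
    show "absolutely_continuous_on_interval c d y"
      using AC cd unfolding y_def[abs_def] by (rule AC_interval_subinterval)
    show "continuous_on {c..d} (\<lambda>t. k * g (u t))"
      by (intro continuous_on_mult continuous_on_const continuous_on_subset[OF gu]) (use cd in auto)
    have "AE t in lebesgue. t \<notin> {d}"
      by (intro AE_not_in null_sets_completionI finite_imp_null_set_lborel) simp
    then show "AE t\<in>{c..d} in lebesgue. (y has_real_derivative k * g (u t)) (at t within {c..d})"
      using ae
    proof eventually_elim
      case (elim t)
      show ?case
      proof
        assume t: "t \<in> {c..d}"
        then obtain w where w: "(y has_real_derivative w) (at t within {0..T})" "w + a t * g (u t) = 0"
          using elim(2) cd unfolding y_def[abs_def] by auto
        have "a t = - k" using ak t elim(1) by auto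
        then have "w = k * g (u t)" using w(2) by simp
        then show "(y has_real_derivative k * g (u t)) (at t within {c..d})"
          using w(1) cd by (auto intro: DERIV_subset)
      qed
    qed
  qed
  show ?thesis
  proof
    show "arc 1 ap \<tau> u y"
      unfolding arc_def
    proof (intro conjI ballI)
      fix t assume t: "t \<in> {0..\<tau>}"
      then have tT: "t \<in> {0..T}" using \<tau> by auto
      show "u t > 0" using pos[OF tT] .
      show "(u has_real_derivative 1 * h (y t)) (at t within {0..\<tau>})"
        using DERIV_subset[OF u'[OF tT], of "{0..\<tau>}"] hy[OF tT] \<tau> by simp
      show "(y has_real_derivative - ap * g (u t)) (at t within {0..\<tau>})"
        by (rule piece[OF _ _ _ t]) (use \<tau> a in auto)
    qed (rule y0)
    show "arc (- 1) am (T - \<tau>) (\<lambda>s. u (T - s)) (\<lambda>s. y (T - s))"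
      unfolding arc_def
    proof (intro conjI ballI)
      fix s assume s: "s \<in> {0..T - \<tau>}"
      then have t: "T - s \<in> {\<tau>..T}" by auto
      then have tT: "T - s \<in> {0..T}" using \<tau> by auto
      have img: "(\<lambda>s. T - s) ` {0..T - \<tau>} \<subseteq> {\<tau>..T}" by auto
      show "u (T - s) > 0" using pos[OF tT] .
      have "(u has_real_derivative h (y (T - s))) (at (T - s) within {\<tau>..T})"
        using DERIV_subset[OF u'[OF tT], of "{\<tau>..T}"] hy[OF tT] \<tau> by simp
      from has_real_derivative_time_reversal[OF this img]
      show "((\<lambda>s. u (T - s)) has_real_derivative - 1 * h (y (T - s))) (at s within {0..T - \<tau>})"
        by simp
      have "(y has_real_derivative am * g (u (T - s))) (at (T - s) within {\<tau>..T})"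
        by (rule piece[OF _ _ _ t]) (use \<tau> a in auto)
      from has_real_derivative_time_reversal[OF this img]
      show "((\<lambda>s. y (T - s)) has_real_derivative - am * g (u (T - s))) (at s within {0..T - \<tau>})"
        by simp
    qed (simp add: y0)
  qed
qed

text \<open>
  At \<open>\<tau>\<close> the momentum \<open>y\<close> has a corner, but \<open>u' = h y\<close> only needs \<open>y\<close> to be continuous. Being Lipschitz on
  both pieces, \<open>y\<close> is absolutely continuous.
\<close>
lemma arcs_imp_solution:
  assumes a1: "arc 1 ap \<tau> x1 y1" and a2: "arc (- 1) am (T - \<tau>) x2 y2"
    and match: "x1 \<tau> = x2 (T - \<tau>)" "y1 \<tau> = y2 (T - \<tau>)"
  shows "solution (\<lambda>t\<in>{0..T}. if t \<le> \<tau> then x1 t else x2 (T - t))"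
proof -
  define u where "u = (\<lambda>t\<in>{0..T}. if t \<le> \<tau> then x1 t else x2 (T - t))"
  define y where "y t = (if t \<le> \<tau> then y1 t else y2 (T - t))" for t
  have u1: "u t = x1 t" "y t = y1 t" if "t \<in> {0..\<tau>}" for t using that \<tau> by (auto simp: u_def y_def)
  have u2: "u t = x2 (T - t)" "y t = y2 (T - t)" if "t \<in> {\<tau>..T}" for t
    using that \<tau> match by (auto simp: u_def y_def)
  have T2: "T - t \<in> {0..T - \<tau>}" if "t \<in> {\<tau>..T}" for t using that by auto
  have img: "(\<lambda>t. T - t) ` {\<tau>..T} \<subseteq> {0..T - \<tau>}" by auto
  have split: "{0..T} = {0..\<tau>} \<union> {\<tau>..T}" using \<tau> by auto
  have pos: "u t > 0" if "t \<in> {0..T}" for t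
    using that arcD(2)[OF a1, of t] arcD(2)[OF a2 T2, of t] u1(1) u2(1) unfolding split by auto
  have ud1: "(u has_real_derivative h (y t)) (at t within {0..\<tau>})" if t: "t \<in> {0..\<tau>}" for t
    by (rule has_field_derivative_transform_within[OF _ zero_less_one t])
       (use arcD(3)[OF a1 t] u1 t in simp_all)
  have yd1: "(y has_real_derivative - ap * g (u t)) (at t within {0..\<tau>})" if t: "t \<in> {0..\<tau>}" for t
    by (rule has_field_derivative_transform_within[OF _ zero_less_one t])
       (use arcD(4)[OF a1 t] u1 t in simp_all)
  have ud2: "(u has_real_derivative h (y t)) (at t within {\<tau>..T})" if t: "t \<in> {\<tau>..T}" for t
    by (rule has_field_derivative_transform_within[OF _ zero_less_one t])
       (use has_real_derivative_time_reversal[OF arcD(3)[OF a2 T2[OF t]] img] u2 t in simp_all)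
  have yd2: "(y has_real_derivative am * g (u t)) (at t within {\<tau>..T})" if t: "t \<in> {\<tau>..T}" for t
    by (rule has_field_derivative_transform_within[OF _ zero_less_one t])
       (use has_real_derivative_time_reversal[OF arcD(4)[OF a2 T2[OF t]] img] u2 t in simp_all)
  have ud: "(u has_real_derivative h (y t)) (at t within {0..T})" if "t \<in> {0..T}" for t
    using that ud1 ud2 unfolding split by (intro has_real_derivative_closed_Un) auto
  have ucont: "continuous_on {0..T} u" using ud by (rule DERIV_continuous_on)
  have gu: "continuous_on {0..T} (\<lambda>t. g (u t))"
    by (rule continuous_on_compose2[OF g(1) ucont]) (use pos in auto)
  obtain C1 where C1: "C1-lipschitz_on {0..\<tau>} y"
    by (rule lipschitz_on_continuous_derivative[OF yd1])
       (use gu \<tau> in \<open>auto intro!: continuous_on_mult continuous_on_minus intro: continuous_on_subset\<close>)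
  obtain C2 where C2: "C2-lipschitz_on {\<tau>..T} y"
    by (rule lipschitz_on_continuous_derivative[OF yd2])
       (use gu \<tau> in \<open>auto intro!: continuous_on_mult intro: continuous_on_subset\<close>)
  have lip: "(max C1 C2)-lipschitz_on {0..T} y"
    using lipschitz_on_concat_max[OF C1 C2] by simp
  have "continuous_on {0..T} (\<lambda>t. h (y t))"
    using lipschitz_on_continuous_on[OF lip] by (rule continuous_on_compose2[OF h_cont]) simp
  moreover have "absolutely_continuous_on_interval 0 T (\<lambda>t. \<phi> (h (y t)))"
    using lipschitz_imp_AC_interval[OF lip] by (simp add: \<phi>_h)
  moreover have "AE t\<in>{0..T} in lebesgue. \<exists>w. ((\<lambda>s. \<phi> (h (y s))) has_real_derivative w) (at t within {0..T}) \<and>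
              w + a t * g (u t) = 0"
  proof -
    have "AE t in lebesgue. t \<notin> {\<tau>, T}"
      by (intro AE_not_in null_sets_completionI finite_imp_null_set_lborel) simp
    then show ?thesis
    proof eventually_elim
      case (elim t)
      show ?case
      proof
        assume t: "t \<in> {0..T}"
        show "\<exists>w. ((\<lambda>s. \<phi> (h (y s))) has_real_derivative w) (at t within {0..T}) \<and> w + a t * g (u t) = 0"
        proof (cases "t < \<tau>")
          case True
          then have "(y has_real_derivative - ap * g (u t)) (at t within {0..T})"
            using yd1[of t] t unfolding split by (intro has_real_derivative_closed_Un) auto
          then show ?thesis using a(1)[of t] True t by (intro exI[of _ "- ap * g (u t)"]) (simp add: \<phi>_h)
        next
          case False
          then have "(y has_real_derivative am * g (u t)) (at t within {0..T})"
            using yd2[of t] t elim unfolding split by (intro has_real_derivative_closed_Un) auto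
          then show ?thesis using a(2)[of t] False t elim by (intro exI[of _ "am * g (u t)"]) (simp add: \<phi>_h)
        qed
      qed
    qed
  qed
  moreover have "u \<in> {0..T} \<rightarrow>\<^sub>E {0<..}" using pos by (auto simp: u_def)
  ultimately have "positive_solution \<Omega> \<phi> a g T u"
    unfolding positive_solution_def using ud h_in by (intro conjI exI[of _ "\<lambda>t. h (y t)"]) auto
  moreover have "h (y 0) = 0" "h (y T) = 0"
    using arcD(1)[OF a1] arcD(1)[OF a2] \<tau> h_0 by (auto simp: y_def)
  ultimately show ?thesis
    using ud[of 0] ud[of T] \<tau> unfolding neumann_positive_solution_def u_def by simp
qed

section \<open>Solutions of the Neumann problem and solutions of the system\<close>

abbreviation solves_system :: "real \<times> real \<Rightarrow> bool" where
  "solves_system \<equiv> \<lambda>(\<omega>, \<sigma>). (\<omega>, \<sigma>) \<in> \<O> G \<and> M_I h g G ap am \<omega> \<sigma> = \<tau> \<and> M_II h g G ap am \<omega> \<sigma> = T - \<tau>"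

text \<open>
  Equality of the kinetic energies with which the two arcs reach the potential level \<open>m\<close>.
\<close>
lemma junction_iff: "ap * (\<omega> - m) = am * (m - \<sigma>) \<longleftrightarrow> m = \<mu> ap am * \<omega> + (1 - \<mu> ap am) * \<sigma>"
proof -
  define S where "S = ap + am"
  have S: "S > 0" using weights by (simp add: S_def)
  have "1 - ap / S = am / S" using S by (simp add: S_def field_simps)
  then have mean: "\<mu> ap am * \<omega> + (1 - \<mu> ap am) * \<sigma> = (ap * \<omega> + am * \<sigma>) / S"
    by (simp add: \<mu>_def S_def[symmetric] add_divide_distrib)
  have "m = (ap * \<omega> + am * \<sigma>) / S \<longleftrightarrow> m * S = ap * \<omega> + am * \<sigma>"
    using S by (simp add: eq_divide_eq)
  then show ?thesis unfolding mean by (auto simp: S_def algebra_simps)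
qed

lemma solution_levels:
  assumes "solution u"
  shows "u 0 > 0" "u \<tau> > 0" "u T > 0"
    and "G (u 0) > G (u T)"
    and "G (u \<tau>) = \<mu> ap am * G (u 0) + (1 - \<mu> ap am) * G (u T)"
proof -
  obtain y where y: "arc 1 ap \<tau> u y" "arc (- 1) am (T - \<tau>) (\<lambda>s. u (T - s)) (\<lambda>s. y (T - s))"
    using solution_imp_arcs[OF assms] .
  show "u 0 > 0" "u \<tau> > 0" "u T > 0"
    using arcD(2)[OF y(1), of 0] arcD(2)[OF y(1), of \<tau>] arcD(2)[OF y(2), of 0] \<tau> by auto
  have "H h (y \<tau>) = ap * (G (u 0) - G (u \<tau>))" "H h (y \<tau>) = am * (G (u \<tau>) - G (u T))"
    using arc_energy[OF y(1), of \<tau>] arc_energy[OF y(2), of "T - \<tau>"] \<tau> by auto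
  moreover have "H h (y \<tau>) > 0"
    using H_less[of "y \<tau>" 0] H_0 arc_momentum_neg[OF y(1), of \<tau>] \<tau> weights by simp
  ultimately have E: "ap * (G (u 0) - G (u \<tau>)) > 0" "am * (G (u \<tau>) - G (u T)) > 0"
    "ap * (G (u 0) - G (u \<tau>)) = am * (G (u \<tau>) - G (u T))" by auto
  have "G (u 0) > G (u \<tau>)" "G (u \<tau>) > G (u T)"
    using E(1,2) weights by (simp_all add: zero_less_mult_iff)
  then show "G (u 0) > G (u T)" by simp
  show "G (u \<tau>) = \<mu> ap am * G (u 0) + (1 - \<mu> ap am) * G (u T)"
    using E(3) unfolding junction_iff .
qed

lemma solution_solves_system:
  assumes "solution u"
  shows "solves_system (G (u 0), G (u T))"
proof -
  obtain y where y: "arc 1 ap \<tau> u y" "arc (- 1) am (T - \<tau>) (\<lambda>s. u (T - s)) (\<lambda>s. y (T - s))"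
    using solution_imp_arcs[OF assms] .
  note l = solution_levels[OF assms]
  show ?thesis
    using arc_time_forward[OF y(1)] arc_time_backward[OF y(2)] l weights \<tau>
    by (auto simp: \<O>_def M_I_def M_II_def)
qed

text \<open>
  The durations \<open>L1\<close> and \<open>L2\<close> of the two arcs are not known when they are constructed. The time
  formula then identifies them as \<open>M_I\<close> and \<open>M_II\<close>, which the system prescribes.
\<close>
lemma system_solution_exists:
  assumes "solves_system (\<omega>, \<sigma>)"
  obtains u where "solution u" "G (u 0) = \<omega>" "G (u T) = \<sigma>"
proof -
  obtain x0 xT where x: "x0 > 0" "G x0 = \<omega>" "xT > 0" "G xT = \<sigma>" and less: "\<sigma> < \<omega>"
    and MI: "M_I h g G ap am \<omega> \<sigma> = \<tau>" and MII: "M_II h g G ap am \<omega> \<sigma> = T - \<tau>"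
    using assms by (auto simp: \<O>_def)
  define m where "m = \<mu> ap am * \<omega> + (1 - \<mu> ap am) * \<sigma>"
  have junction: "ap * (\<omega> - m) = am * (m - \<sigma>)" unfolding junction_iff m_def ..
  have m\<omega>: "m < \<omega>"
  proof (rule ccontr)
    assume "\<not> m < \<omega>"
    then have "ap * (\<omega> - m) \<le> 0" "am * (m - \<sigma>) > 0" using less weights by (auto simp: mult_le_0_iff)
    with junction show False by simp
  qed
  then have c: "ap * (\<omega> - m) > 0" using weights by simp
  then have "\<sigma> < m" using junction weights by (simp add: zero_less_mult_iff)
  with m\<omega> obtain xm where xm: "xm > 0" "G xm = m"
    using G_ivt[OF x(1,3), of m] x by (auto simp: closed_segment_eq_real_ivl)
  obtain z where z: "z \<le> 0" "H h z = ap * (\<omega> - m)" using H_surj[of "ap * (\<omega> - m)"] c by auto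
  define b where "b = - z"
  have b: "b > 0" using z c H_0 by (cases "z = 0") (auto simp: b_def)
  obtain L1 x1 y1 where 1: "L1 > 0" "arc 1 ap L1 x1 y1" "x1 0 = x0" "x1 L1 = xm" "y1 L1 = - b"
    by (rule arc_exists[OF x(1) xm(1) _ weights(1) b, of 1]) (use z x xm in \<open>auto simp: b_def\<close>)
  obtain L2 x2 y2 where 2: "L2 > 0" "arc (- 1) am L2 x2 y2" "x2 0 = xT" "x2 L2 = xm" "y2 L2 = - b"
    by (rule arc_exists[OF x(3) xm(1) _ weights(2) b, of "- 1"]) (use z x xm junction in \<open>auto simp: b_def\<close>)
  have L1: "L1 = \<tau>"
    using arc_time_forward[OF 1(2) weights(1) 1(1)] MI 1 x xm by (simp add: M_I_def m_def)
  have L2: "L2 = T - \<tau>"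
    using arc_time_backward[OF 2(2) weights(2) 2(1)] MII 2 x xm by (simp add: M_II_def m_def)
  show ?thesis
  proof
    show "solution (\<lambda>t\<in>{0..T}. if t \<le> \<tau> then x1 t else x2 (T - t))"
      by (rule arcs_imp_solution[where ?y1.0 = y1 and ?y2.0 = y2]) (use 1 2 L1 L2 in auto)
  qed (use 1 2 x \<tau> in auto)
qed

text \<open>
  The levels at \<open>0\<close> and \<open>T\<close> fix the level at \<open>\<tau>\<close>, so uniqueness of arcs applies to both halves.
\<close>
lemma solution_determined_by_levels:
  assumes u: "solution u" and v: "solution v" and eq: "G (u 0) = G (v 0)" "G (u T) = G (v T)"
  shows "u = v"
proof
  fix t
  obtain y where y: "arc 1 ap \<tau> u y" "arc (- 1) am (T - \<tau>) (\<lambda>s. u (T - s)) (\<lambda>s. y (T - s))"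
    using solution_imp_arcs[OF u] .
  obtain z where z: "arc 1 ap \<tau> v z" "arc (- 1) am (T - \<tau>) (\<lambda>s. v (T - s)) (\<lambda>s. z (T - s))"
    using solution_imp_arcs[OF v] .
  note lu = solution_levels[OF u] and lv = solution_levels[OF v]
  have "G (u \<tau>) = G (v \<tau>)" using lu(5) lv(5) eq by simp
  then have ends: "u 0 = v 0" "u \<tau> = v \<tau>" "u T = v T"
    using eq lu lv by (auto intro: inj_onD[OF G_inj])
  consider "t \<in> {0..\<tau>}" | "t \<in> {\<tau>..T}" | "t \<notin> {0..T}" by force
  then show "u t = v t"
  proof cases
    case 1
    then show ?thesis using arc_unique[OF y(1) z(1)] ends weights \<tau> by simp
  next
    case 2
    then show ?thesis using arc_unique[OF y(2) z(2), of "T - t"] ends weights \<tau> by simp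
  next
    case 3
    then show ?thesis
      using u v unfolding neumann_positive_solution_def positive_solution_def by (metis PiE_arb)
  qed
qed

end

theorem theorem2p1:
  fixes \<Omega> :: "real set" and \<phi> h g G a :: "real \<Rightarrow> real" and \<tau> T ap am :: real
  assumes \<Omega>: "open \<Omega>" "is_interval \<Omega>" "0 \<in> \<Omega>"
    and \<phi>: "homeomorphism \<Omega> UNIV \<phi> h" "\<phi> 0 = 0" "\<And>s. s \<in> \<Omega> - {0} \<Longrightarrow> \<phi> s * s > 0"
    and \<tau>: "0 < \<tau>" "\<tau> < T"
    and weights: "ap > 0" "am > 0"
    and a: "\<And>t. t \<in> {0..<\<tau>} \<Longrightarrow> a t = ap" "\<And>t. t \<in> {\<tau>..<T} \<Longrightarrow> a t = - am"
    and g: "continuous_on {0<..} g" "\<And>x. x > 0 \<Longrightarrow> g x > 0"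
    and G: "normalized_primitive g G"
  shows "((\<exists>(\<omega>, \<sigma>)\<in>\<O> G. M_I h g G ap am \<omega> \<sigma> = \<tau> \<and> M_II h g G ap am \<omega> \<sigma> = T - \<tau>)
            \<longleftrightarrow> (\<exists>u. neumann_positive_solution \<Omega> \<phi> a g T u)) \<and>
         ((\<exists>!(\<omega>, \<sigma>). (\<omega>, \<sigma>) \<in> \<O> G \<and> M_I h g G ap am \<omega> \<sigma> = \<tau> \<and> M_II h g G ap am \<omega> \<sigma> = T - \<tau>)
            \<longleftrightarrow> (\<exists>!u. neumann_positive_solution \<Omega> \<phi> a g T u))"
proof -
  have G': "(G has_real_derivative g x) (at x)" if "x > 0" for x
    using G that by (simp add: normalized_primitive_def)
  interpret indefinite_neumann \<Omega> \<phi> h g G a \<tau> T ap am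
    by unfold_locales (fact assms G')+
  define levels where "levels u = (G (u 0), G (u T))" for u :: "real \<Rightarrow> real"
  have into: "solves_system (levels u)" if "solution u" for u
    using solution_solves_system[OF that] by (simp add: levels_def)
  have onto: "\<exists>u. solution u \<and> levels u = p" if "solves_system p" for p
  proof -
    obtain \<omega> \<sigma> where p: "p = (\<omega>, \<sigma>)" by (cases p)
    with that have "solves_system (\<omega>, \<sigma>)" by (simp only:)
    then obtain u where "solution u" "G (u 0) = \<omega>" "G (u T) = \<sigma>" by (rule system_solution_exists)
    then show ?thesis unfolding p levels_def by blast
  qed
  have inj: "u = v" if "solution u" "solution v" "levels u = levels v" for u v
    using solution_determined_by_levels[OF that(1,2)] that(3) by (simp add: levels_def)
  have "(\<exists>p. solves_system p) \<longleftrightarrow> (\<exists>u. solution u)" using into onto by blast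
  moreover have "(\<exists>!p. solves_system p) \<longleftrightarrow> (\<exists>!u. solution u)"
  proof
    assume "\<exists>!p. solves_system p"
    then obtain p where p: "solves_system p" "\<And>q. solves_system q \<Longrightarrow> q = p" by (rule ex1E) blast
    from onto[OF p(1)] obtain u where u: "solution u" "levels u = p" by blast
    show "\<exists>!u. solution u"
    proof (rule ex1I)
      show "v = u" if "solution v" for v using inj[OF that u(1)] p(2)[OF into[OF that]] u(2) by simp
    qed (fact u(1))
  next
    assume "\<exists>!u. solution u"
    then obtain u where u: "solution u" "\<And>v. solution v \<Longrightarrow> v = u" by (rule ex1E) blast
    show "\<exists>!p. solves_system p"
    proof (rule ex1I)
      show "solves_system (levels u)" using into[OF u(1)] .
      show "p = levels u" if "solves_system p" for p using onto[OF that] u(2) by blast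
    qed
  qed
  ultimately show ?thesis by auto
qed

end
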